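(* Let $R$ be a Gorenstein local (or graded) ring with infinite residue field and $\frac12\in R$, let $\mathbb A$ be the minimal free resolution of a perfect $R$-module $M$, and let $\mathbb D$ be the free resolution of a module $M'$ minimally BR-linked to $M$ by means of the first four columns of $a_1$ (with the bases given in the context). Put $\varepsilon=e_1\wedge\dots\wedge e_4$, $\sigma=s_1\wedge\dots\wedge s_4$. Right-hand sides below are maps of $\mathbb A$. Assume $\mathbb A$ to be of format $(2,6,5,1)$ and $\mathbb D$ of format $(2,5,5,2)$. Then some entries of the map $w^{(1)}_{2,1}:\bigwedge^5D_1\otimes\bigwedge^2D_1\to D_0\otimes\bigwedge^2D_3$ of $\mathbb D$ are described as follows: $$w^{(1)}_{2,1}(\sigma\wedge\gamma_1\otimes s_1\wedge\gamma_1)=\sum_{j=1}^2\langle w^{(1)}_{2,2}(\varepsilon\wedge e_5\wedge e_6\otimes e_1),u_j^*\otimes\gamma_1\otimes\gamma_1\rangle\,(u_j\otimes\epsilon_5\wedge\epsilon_6).$$ Assume $\mathbb A$ to be of format $(2,5,5,2)$ and $\mathbb D$ of format $(2,6,5,1)$. Then some entries of the map $w^{(1)}_{2,2}:\bigwedge^6D_1\otimes D_1\to D_0\otimes S_2D_3$ of $\mathbb D$ are described as follows: $$w^{(1)}_{2,2}(\sigma\wedge\gamma_1\wedge\gamma_2\otimes\gamma_1)=\sum_{j=1}^2\langle w^{(1)}_3(\varepsilon\wedge e_5\otimes\varepsilon\wedge e_5),u_j^*\otimes\gamma_1\wedge\gamma_2\otimes\gamma_1\rangle\,(u_j\otimes\epsilon_5\cdot\epsilon_5).$$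 The same formulas hold for all the analogous combinations of basis elements $\gamma_t$ and $s_j$.
   Context: A module is perfect if its projective dimension equals the grade of its annihilator. The format of $0\to F_3\to F_2\to F_1\to F_0$ is the sequence of ranks $(r_0,r_1,r_2,r_3)$. Structure maps. Let $\mathbb F:0\to F_3\xrightarrow{d_3}F_2\xrightarrow{d_2}F_1\xrightarrow{d_1}F_0$ be a free resolution, $F_0=R^2$ with basis $u_1,u_2$; $e_i$, $f_h$ bases of $F_1$, $F_2$. $m_{ij}$ is the $2\times2$ minor of $d_1$ on columns $i,j$ ($m_{ji}=-m_{ij}$). Identify $\bigwedge^2F_0=R$ by $u_1\wedge u_2=1$, and for $v\in F_0$, $c=\sum_ju_j\otimes g_j\in F_0\otimes F_3$ put $v\wedge c=\sum_j(v\wedge u_j)g_j\in F_3$ and $c\wedge v=-v\wedge c$. The maps are obtained by lifting the indicated elements; when a lift is not unique some choice is fixed. Formulas are written for one choice of indices; the other entries are defined analogously, respecting skew-symmetry. Write $e_ie_je_k:=w^{(3)}_1(e_i\wedge e_j\wedge e_k)$, $\varepsilon_{1,\dots,i}=e_1\wedge\dots\wedge e_i$, hats denoting omission; tensor factors are reordered freely. Let $\iota:\bigwedge^2F_3\to F_3\otimes F_2$, $\iota(a\wedge b)=d_3(a)\otimes b-a\otimes d_3(b)$, and $\kappa:S_2F_3\to F_2\otimes F_3$, $\kappa(ab)=d_3(a)\otimes b+d_3(b)\otimes a$. - $w^{(3)}_1:\bigwedge^3F_1\to F_2$: $d_2(e_ie_je_k)=m_{ij}e_k-m_{ik}e_j+m_{jk}e_i$.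 - $w^{(2)}_1:\bigwedge^2F_1\otimes F_2\to F_3$: $d_3w^{(2)}_1(e_i\wedge e_j\otimes f_h)=m_{ij}f_h-w^{(3)}_1(d_2(f_h)\wedge e_i\wedge e_j)$. - $w^{(1)}_1:\bigwedge^4F_1\to F_0\otimes F_3$: $(1\otimes d_3)w^{(1)}_1(\varepsilon_{1,2,3,4})=\sum_{j=1}^4(-1)^{j+1}d_1(e_j)\otimes w^{(3)}_1(\varepsilon_{1,\dots,\hat j,\dots,4})$. - $w^{(3)}_{2,1}:\bigwedge^5F_1\otimes F_1\to F_2\otimes F_3$ and $w^{(3)}_{2,2}:\bigwedge^6F_1\to F_2\otimes F_3$ (the latter zero if $r_1=5$) are lifts along the map $F_3\otimes F_2\to S_2F_2$ induced by $d_3$: $w^{(3)}_{2,1}(\varepsilon_{1,\dots,5}\otimes e_1)$ lifts $e_1e_2e_3\otimes e_1e_4e_5-e_1e_2e_4\otimes e_1e_3e_5+e_1e_2e_5\otimes e_1e_3e_4$, and $w^{(3)}_{2,2}(\varepsilon_{1,\dots,6})$ lifts $\sum_{1\le i<j\le5}(-1)^{i+j+1}e_ie_je_6\otimes w^{(3)}_1(\varepsilon_{1,\dots,\hat i,\hat j,\dots,5})$, both seen as elements of $S_2F_2$. - $w^{(2)}_{2,1}:\bigwedge^4F_1\otimes F_1\otimes F_2\to\bigwedge^2F_3$ is a lift along $\iota$, with two formulas depending on the configuration of the basis elements (equivalent up to multiplying by a constant): $w^{(2)}_{2,1}(\varepsilon_{1,2,3,4}\otimes e_1\otimes f_h)$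 lifts $e_1e_2e_3\otimes w^{(2)}_1(e_1\wedge e_4\otimes f_h)-e_1e_2e_4\otimes w^{(2)}_1(e_1\wedge e_3\otimes f_h)+e_1e_3e_4\otimes w^{(2)}_1(e_1\wedge e_2\otimes f_h)+f_h\otimes d_1(e_1)\wedge w^{(1)}_1(\varepsilon_{1,2,3,4})-w^{(3)}_{2,1}(\varepsilon_{1,2,3,4}\wedge d_2(f_h)\otimes e_1)$; and $w^{(2)}_{2,1}(\varepsilon_{1,2,3,4}\otimes e_5\otimes f_h)$ lifts $\sum_{1\le i<j\le4}(-1)^{i+j+1}w^{(2)}_1(\varepsilon_{1,\dots,\hat i,\hat j,\dots,4}\otimes f_h)\otimes e_ie_je_5+\sum_{1\le i\le4}(-1)^iw^{(2)}_1(e_i\wedge e_5\otimes f_h)\otimes w^{(3)}_1(\varepsilon_{1,\dots,\hat i,\dots,4})+\frac12f_h\otimes\sum_{1\le i\le5}(-1)^iw^{(1)}_1(\varepsilon_{1,\dots,\hat i,\dots,5})\wedge d_1(e_i)-w^{(3)}_{2,1}(\varepsilon_{1,2,3,4}\wedge d_2(f_h)\otimes e_5)$. - $w^{(2)}_{2,2}:\bigwedge^5F_1\otimes F_2\to S_2F_3$: $w^{(2)}_{2,2}(\varepsilon_{1,\dots,5}\otimes f_h)$ lifts along $\kappa$ the element $\sum_{i<j<k}(-1)^{i+j+k}e_ie_je_k\otimes w^{(2)}_1(\varepsilon_{1,\dots,\hat i,\hat j,\hat k,\dots,5}\otimes f_h)+\frac12f_h\otimes\sum_i(-1)^id_1(e_i)\wedge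 w^{(1)}_1(\varepsilon_{1,\dots,\hat i,\dots,5})-w^{(3)}_{2,2}(\varepsilon_{1,\dots,5}\wedge d_2(f_h))$. - (when $r_1=5$) $w^{(1)}_{2,1}:\bigwedge^5F_1\otimes\bigwedge^2F_1\to F_0\otimes\bigwedge^2F_3$: $w^{(1)}_{2,1}(\varepsilon_{1,\dots,5}\otimes e_1\wedge e_2)$ lifts along $\iota\otimes\mathrm{id}_{F_0}$ the element $\sum_{i=3}^5(-1)^{i+1}e_1e_2e_i\otimes w^{(1)}_1(\varepsilon_{1,\dots,\hat i,\dots,5})+\sum_{j=1}^2(-1)^jd_1(e_j)\otimes w^{(3)}_{2,1}(\varepsilon_{1,\dots,5}\otimes e_{3-j})$. - (when $r_1=6$) $w^{(1)}_{2,2}:\bigwedge^6F_1\otimes F_1\to F_0\otimes S_2F_3$: $w^{(1)}_{2,2}(\varepsilon_{1,\dots,6}\otimes e_1)$ lifts along $\kappa\otimes\mathrm{id}_{F_0}$ the element $\sum_{2\le i<j\le6}(-1)^{i+j+1}e_1e_ie_j\otimes w^{(1)}_1(\varepsilon_{1,\dots,\hat i,\hat j,\dots,6})+d_1(e_1)\otimes w^{(3)}_{2,2}(\varepsilon_{1,\dots,6})$. - (when $r_1=5$) $w^{(1)}_3:\bigwedge^5F_1\otimes\bigwedge^5F_1\to F_0\otimes\bigwedge^2F_3\otimes F_3$: $w^{(1)}_3(\varepsilon_{1,\dots,5}\otimes\varepsilon_{1,\dots,5})$ lifts, along $\mathrm{id}_{F_0}$ tensored with $\bigwedge^2F_3\otimes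 F_3\to F_3\otimes F_3\otimes F_2$, $a\wedge b\otimes c\mapsto[d_3(a)\otimes b-a\otimes d_3(b)]\otimes c$, the element $\sum_{i=1}^5(-1)^{i+1}w^{(1)}_1(\varepsilon_{1,\dots,\hat i,\dots,5})\otimes w^{(3)}_{2,1}(\varepsilon_{1,\dots,5}\otimes e_i)$. The pairing of an element of $S_2F_3$ with $\gamma_t\otimes\gamma_t$ is its coefficient at $g_t\cdot g_t$. The linked complex. Let $\mathbb A:0\to A_3\xrightarrow{a_3}A_2\xrightarrow{a_2}A_1\xrightarrow{a_1}A_0$ (format $(2,r_1,r_2,r_3)$) have bases $\{e_k\}$ of $A_1$, $\{f_h\}$ of $A_2$, $\{g_t\}$ of $A_3$, dual bases $\{\epsilon_k\},\{\phi_h\},\{\gamma_t\}$ of $A_1^*,A_2^*,A_3^*$; $\langle\cdot,\cdot\rangle$ is evaluation. Let $x_{ij},y_{ij},z_{ij}$ be the entries of the matrices of $a_1,a_2,a_3$. Assume the ideal of $2\times2$ minors of the first four columns of $a_1$ has height 3. Let $\{s_1,\dots,s_4\}$ be a basis of $B_1=R^4$, $b_1(s_i)=a_1(e_i)$, and let $\mathbb B$ be the Buchsbaum--Rim complex resolving $\operatorname{coker}b_1$, with basis $\{t_1,\dots,t_4\}$ of $B_2$ and differential $b_2:B_2\to B_1$. The minimally BR-linked module $M'$ is the one resolved by $\mathbb D:0\to A_1^*\xrightarrow{d_3}A_2^*\oplus B_2\xrightarrow{d_2}A_3^*\oplus B_1\xrightarrow{d_1}D_0=A_0$, the mapping cone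 of the map $\mathbb A^*\to\mathbb B$, with components $\beta_i:A_i^*\to B_{3-i}$, dual (via the self-duality of $\mathbb B$) to the comparison map $\mathbb B\to\mathbb A$ lifting the identity of $A_0$ and sending $s_i\mapsto e_i$. Its differentials are $$d_1=\begin{bmatrix}\beta_3&b_1\end{bmatrix},\quad d_2=\begin{bmatrix}a_3^*&0\\-\beta_2&-b_2\end{bmatrix},\quad d_3=\begin{bmatrix}a_2^*\\\beta_1\end{bmatrix},$$ where $\beta_1(\epsilon_k)=t_k$ for $k\le4$ and $0$ otherwise; $\beta_2(\phi_h)=\langle e_2e_3e_4,\phi_h\rangle s_1-\langle e_1e_3e_4,\phi_h\rangle s_2+\langle e_1e_2e_4,\phi_h\rangle s_3-\langle e_1e_2e_3,\phi_h\rangle s_4$; $\beta_3(\gamma_t)=\sum_{j=1}^2\langle w^{(1)}_1(\varepsilon),\gamma_t\otimes u_j^*\rangle u_j$. The elements $\epsilon_1,\dots,\epsilon_4$ are redundant and are removed, with $t_j=\sum_hy_{jh}\phi_h$; after this, $D_1,D_2,D_3$ have bases $\{\gamma_1,\dots,\gamma_{r_3},s_1,\dots,s_4\}$, $\{\phi_1,\dots,\phi_{r_2}\}$, $\{\epsilon_5,\dots,\epsilon_{r_1}\}$. Lower structure maps of $\mathbb D$ used (right-hand sides refer to $\mathbb A$; analogous formulas for the other indices): $w^{(3)}_1(s_i\wedge s_j\wedge s_k)=(-1)^rt_r$ for $i<j<k$, $\{i,j,k,r\}=\{1,2,3,4\}$; $w^{(3)}_1(s_i\wedge s_j\wedge\gamma_t)=\sum_h\langle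 w^{(2)}_1(e_i\wedge e_j\otimes f_h),\gamma_t\rangle\phi_h$; $w^{(3)}_1(s_i\wedge\gamma_1\wedge\gamma_2)=\sum_h\langle w^{(2)}_{2,1}(\varepsilon\otimes e_i\otimes f_h),\gamma_1\wedge\gamma_2\rangle\phi_h$; $w^{(1)}_1(s_1\wedge s_2\wedge s_3\wedge\gamma_t)=\sum_{j}\sum_{k\ge5}\langle w^{(1)}_1(e_1\wedge e_2\wedge e_3\wedge e_k),\gamma_t\otimes u_j^*\rangle(\epsilon_k\otimes u_j)$; $w^{(1)}_1(s_1\wedge s_2\wedge\gamma_1\wedge\gamma_2)=\sum_j\sum_{k\ge5}\langle w^{(1)}_{2,1}(\varepsilon\wedge e_k\otimes e_1\wedge e_2),\gamma_1\wedge\gamma_2\otimes u_j^*\rangle(\epsilon_k\otimes u_j)$; $w^{(3)}_{2,1}(\sigma\wedge\gamma_t\otimes s_j)=\sum_{k\ge5,h}\langle w^{(2)}_1(e_k\wedge e_j\otimes f_h),\gamma_t\rangle(\epsilon_k\otimes\phi_h)$; $w^{(3)}_{2,1}(\sigma\wedge\gamma_t\otimes\gamma_t)=\sum_{k\ge5,h}\langle w^{(2)}_{2,2}(\varepsilon\wedge e_k\otimes f_h),\gamma_t\otimes\gamma_t\rangle(\epsilon_k\otimes\phi_h)$; $w^{(3)}_{2,2}(\sigma\wedge\gamma_1\wedge\gamma_2)=\sum_{k\ge5,h}\langle w^{(2)}_{2,1}(\varepsilon\otimes e_k\otimes f_h),\gamma_1\wedge\gamma_2\rangle(\epsilon_k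\otimes\phi_h)$.
   Formalization: Signs corrected: t_j, w3_{2,1}, one term of w2_{2,2} and w1_{2,1}, and D's w3_1(sγγ), w1_1(sssγ), w3_{2,2}(σγγ); w3_{2,2} is lifted along ∧²F_2, w1_3 along S_2F_3⊗F_2; the second formula for w2_{2,1} is replaced by a liftable one, imposed for r_1=5. *)

theory Defs
  imports
    "Jordan_Normal_Form.Matrix"
    "HOL-Algebra.QuotRing"
    "HOL-Algebra.Ring_Divisibility"
    "HOL-Library.Extended_Nat"
begin

section \<open>Commutative algebra\<close>

text \<open>
  The base ring is a type \<^typ>\<open>'r::comm_ring_1\<close>; \<^term>\<open>type_ring\<close> presents it as a HOL-Algebra
  ring, so that the library notions of ideal, quotient and Noetherian ring apply.
\<close>

definition type_ring :: "'r::comm_ring_1 ring" where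
  "type_ring = \<lparr>carrier = UNIV, mult = (*), one = 1, zero = 0, add = (+)\<rparr>"

definition regular_module :: "('a, 'm) ring_scheme \<Rightarrow> ('a, 'a) module" where
  "regular_module R = \<lparr>carrier = carrier R, mult = (\<otimes>\<^bsub>R\<^esub>), one = \<one>\<^bsub>R\<^esub>, zero = \<zero>\<^bsub>R\<^esub>,
     add = (\<oplus>\<^bsub>R\<^esub>), smult = (\<otimes>\<^bsub>R\<^esub>)\<rparr>"

definition lin_maps ::
  "('a, 'm) ring_scheme \<Rightarrow> ('a, 'b, 'n) module_scheme \<Rightarrow> ('a, 'c, 'k) module_scheme \<Rightarrow> ('b \<Rightarrow> 'c) set"
  where
  "lin_maps R M N = {f. f \<in> carrier M \<rightarrow> carrier N
     \<and> (\<forall>x\<in>carrier M. \<forall>y\<in>carrier M. f (x \<oplus>\<^bsub>M\<^esub> y) = f x \<oplus>\<^bsub>N\<^esub> f y)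
     \<and> (\<forall>r\<in>carrier R. \<forall>x\<in>carrier M. f (r \<odot>\<^bsub>M\<^esub> x) = r \<odot>\<^bsub>N\<^esub> f x)}"

definition kernel_on :: "('a, 'b, 'n) module_scheme \<Rightarrow> ('a, 'c, 'k) module_scheme \<Rightarrow> ('b \<Rightarrow> 'c) \<Rightarrow> 'b set"
  where "kernel_on M N f = {x \<in> carrier M. f x = \<zero>\<^bsub>N\<^esub>}"

text \<open>
  Injective and projective modules are taken, and tested, among the modules carried by the type
  \<^typ>\<open>'a vec\<close> of finite sequences. It has the larger of the cardinality of the ring and
  \<open>\<aleph>\<^sub>0\<close> elements, hence has room for \<open>R\<close> and its ideals (Baer's criterion), for a free module on
  any of these modules, for free resolutions of finitely generated modules, and for the minimal
  injective resolution of a Noetherian ring.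
\<close>

definition injective_module :: "('a, 'm) ring_scheme \<Rightarrow> ('a, 'a vec) module \<Rightarrow> bool" where
  "injective_module R E \<longleftrightarrow> module R E \<and>
     (\<forall>N :: ('a, 'a vec) module. \<forall>H f. module R N \<and> submodule H R N \<and> f \<in> lin_maps R (N\<lparr>carrier := H\<rparr>) E
        \<longrightarrow> (\<exists>g \<in> lin_maps R N E. \<forall>x\<in>H. g x = f x))"

definition projective_module :: "('a, 'm) ring_scheme \<Rightarrow> ('a, 'a vec) module \<Rightarrow> bool" where
  "projective_module R P \<longleftrightarrow> module R P \<and>
     (\<forall>(N :: ('a, 'a vec) module) (N' :: ('a, 'a vec) module) q f.
        module R N \<and> module R N' \<and> q \<in> lin_maps R N N' \<and> q ` carrier N = carrier N' \<and> f \<in> lin_maps R P N'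
        \<longrightarrow> (\<exists>g \<in> lin_maps R P N. \<forall>x\<in>carrier P. q (g x) = f x))"

definition injective_resolution ::
  "('a, 'm) ring_scheme \<Rightarrow> ('a, 'b, 'n) module_scheme \<Rightarrow> (nat \<Rightarrow> ('a, 'a vec) module)
     \<Rightarrow> (nat \<Rightarrow> 'a vec \<Rightarrow> 'a vec) \<Rightarrow> ('b \<Rightarrow> 'a vec) \<Rightarrow> bool" where
  "injective_resolution R M E d \<eta> \<longleftrightarrow>
     (\<forall>i. injective_module R (E i) \<and> d i \<in> lin_maps R (E i) (E (Suc i)))
     \<and> \<eta> \<in> lin_maps R M (E 0) \<and> inj_on \<eta> (carrier M)
     \<and> kernel_on (E 0) (E 1) (d 0) = \<eta> ` carrier M
     \<and> (\<forall>i. kernel_on (E (Suc i)) (E (Suc (Suc i))) (d (Suc i)) = d i ` carrier (E i))"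

definition projective_resolution ::
  "('a, 'm) ring_scheme \<Rightarrow> ('a, 'b, 'n) module_scheme \<Rightarrow> (nat \<Rightarrow> ('a, 'a vec) module)
     \<Rightarrow> (nat \<Rightarrow> 'a vec \<Rightarrow> 'a vec) \<Rightarrow> ('a vec \<Rightarrow> 'b) \<Rightarrow> bool" where
  "projective_resolution R M P d \<eta> \<longleftrightarrow>
     (\<forall>i. projective_module R (P i) \<and> d i \<in> lin_maps R (P (Suc i)) (P i))
     \<and> \<eta> \<in> lin_maps R (P 0) M \<and> \<eta> ` carrier (P 0) = carrier M
     \<and> kernel_on (P 0) M \<eta> = d 0 ` carrier (P 1)
     \<and> (\<forall>i. kernel_on (P (Suc i)) (P i) (d i) = d (Suc i) ` carrier (P (Suc (Suc i))))"

definition projective_dimension :: "('a, 'm) ring_scheme \<Rightarrow> ('a, 'b, 'n) module_scheme \<Rightarrow> enat" where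
  "projective_dimension R M = Inf {enat n | n. \<exists>P d \<eta>. projective_resolution R M P d \<eta>
     \<and> (\<forall>i>n. carrier (P i) = {\<zero>\<^bsub>P i\<^esub>})}"

text \<open>
  Finite self-injective dimension. For a ring which is not local this is equivalent to all
  localizations being Gorenstein as soon as the Krull dimension is finite, which is the case for
  the graded rings below.
\<close>

definition gorenstein :: "('a, 'm) ring_scheme \<Rightarrow> bool" where
  "gorenstein R \<longleftrightarrow> cring R \<and> noetherian_ring R \<and>
     (\<exists>n E d \<eta>. injective_resolution R (regular_module R) E d \<eta> \<and> (\<forall>i>n. carrier (E i) = {\<zero>\<^bsub>E i\<^esub>}))"

definition regular_sequence :: "('a, 'm) ring_scheme \<Rightarrow> 'a list \<Rightarrow> bool" where
  "regular_sequence R xs \<longleftrightarrow> set xs \<subseteq> carrier R \<and> Idl\<^bsub>R\<^esub> (set xs) \<noteq> carrier R \<and>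
     (\<forall>i<length xs. \<forall>r\<in>carrier R.
        r \<otimes>\<^bsub>R\<^esub> xs ! i \<in> Idl\<^bsub>R\<^esub> (set (take i xs)) \<longrightarrow> r \<in> Idl\<^bsub>R\<^esub> (set (take i xs)))"

definition grade :: "('a, 'm) ring_scheme \<Rightarrow> 'a set \<Rightarrow> enat" where
  "grade R I = Sup {enat (length xs) | xs. regular_sequence R xs \<and> set xs \<subseteq> I}"

definition annihilator :: "('a, 'm) ring_scheme \<Rightarrow> ('a, 'b, 'n) module_scheme \<Rightarrow> 'a set" where
  "annihilator R M = {r \<in> carrier R. \<forall>x\<in>carrier M. r \<odot>\<^bsub>M\<^esub> x = \<zero>\<^bsub>M\<^esub>}"

definition perfect_module :: "('a, 'm) ring_scheme \<Rightarrow> ('a, 'b, 'n) module_scheme \<Rightarrow> bool" where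
  "perfect_module R M \<longleftrightarrow> module R M \<and> projective_dimension R M = grade R (annihilator R M)"

definition prime_height :: "('a, 'm) ring_scheme \<Rightarrow> 'a set \<Rightarrow> enat" where
  "prime_height R p = Sup {enat (length ps - 1) | ps. ps \<noteq> [] \<and> last ps = p
     \<and> sorted_wrt (\<subset>) ps \<and> (\<forall>q\<in>set ps. primeideal q R)}"

definition height :: "('a, 'm) ring_scheme \<Rightarrow> 'a set \<Rightarrow> enat" where
  "height R I = Inf {prime_height R p | p. primeideal p R \<and> I \<subseteq> p}"

definition is_local :: "'r::comm_ring_1 set \<Rightarrow> bool" where
  "is_local \<mm> \<longleftrightarrow> maximalideal \<mm> (type_ring :: 'r ring)
     \<and> (\<forall>\<nn>. maximalideal \<nn> (type_ring :: 'r ring) \<longrightarrow> \<nn> = \<mm>)"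

definition grading :: "(nat \<Rightarrow> 'r::comm_ring_1 set) \<Rightarrow> bool" where
  "grading G \<longleftrightarrow> (\<forall>i. additive_subgroup (G i) (type_ring :: 'r ring)) \<and> 1 \<in> G 0
     \<and> (\<forall>i j. \<forall>a\<in>G i. \<forall>b\<in>G j. a * b \<in> G (i + j))
     \<and> (\<forall>r. \<exists>!c. (\<forall>i. c i \<in> G i) \<and> finite {i. c i \<noteq> 0} \<and> r = (\<Sum>i | c i \<noteq> 0. c i))"

definition homogeneous_ideal :: "(nat \<Rightarrow> 'r::comm_ring_1 set) \<Rightarrow> 'r set \<Rightarrow> bool" where
  "homogeneous_ideal G I \<longleftrightarrow> ideal I (type_ring :: 'r ring)
     \<and> (\<forall>c. (\<forall>i. c i \<in> G i) \<and> finite {i. c i \<noteq> 0} \<and> (\<Sum>i | c i \<noteq> 0. c i) \<in> I \<longrightarrow> (\<forall>i. c i \<in> I))"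

text \<open>
  Equivalently the degree-0 part is local (for instance a field), and \<open>\<mm>\<close> is generated by its
  maximal ideal and the elements of positive degree.
\<close>

definition is_graded_local :: "(nat \<Rightarrow> 'r::comm_ring_1 set) \<Rightarrow> 'r set \<Rightarrow> bool" where
  "is_graded_local G \<mm> \<longleftrightarrow> grading G
     \<and> maximalideal \<mm> (type_ring :: 'r ring) \<and> homogeneous_ideal G \<mm>
     \<and> (\<forall>\<nn>. maximalideal \<nn> (type_ring :: 'r ring) \<and> homogeneous_ideal G \<nn> \<longrightarrow> \<nn> = \<mm>)"


section \<open>Complexes of length three\<close>

text \<open>
  A complex \<open>0 \<rightarrow> F\<^sub>3 \<rightarrow> F\<^sub>2 \<rightarrow> F\<^sub>1 \<rightarrow> F\<^sub>0 = R\<^sup>2\<close> of free modules with bases is the triple of the matrices of its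
  differentials. Bases are indexed from 0: \<open>u\<^sub>1\<close>, \<open>e\<^sub>1\<close>, \<open>f\<^sub>1\<close>, \<open>g\<^sub>1\<close> have index 0, and so on; signs such as
  \<open>(-1)\<^sup>i\<close> are shifted accordingly.
\<close>

record 'r complex3 =
  diff1 :: "'r mat"
  diff2 :: "'r mat"
  diff3 :: "'r mat"

abbreviation rk1 :: "'r complex3 \<Rightarrow> nat" where "rk1 X \<equiv> dim_col (diff1 X)"
abbreviation rk2 :: "'r complex3 \<Rightarrow> nat" where "rk2 X \<equiv> dim_col (diff2 X)"
abbreviation rk3 :: "'r complex3 \<Rightarrow> nat" where "rk3 X \<equiv> dim_col (diff3 X)"

definition format :: "'r complex3 \<Rightarrow> nat \<times> nat \<times> nat \<times> nat" where
  "format X = (dim_row (diff1 X), rk1 X, rk2 X, rk3 X)"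

definition free_resolution ::
  "'r::comm_ring_1 complex3 \<Rightarrow> ('r, 'b, 'n) module_scheme \<Rightarrow> ('r vec \<Rightarrow> 'b) \<Rightarrow> bool" where
  "free_resolution X M \<pi> \<longleftrightarrow> module (type_ring :: 'r ring) M
     \<and> dim_row (diff1 X) = 2 \<and> dim_row (diff2 X) = rk1 X \<and> dim_row (diff3 X) = rk2 X
     \<and> \<pi> \<in> lin_maps (type_ring :: 'r ring) (module_vec TYPE('r) 2) M
     \<and> \<pi> ` carrier_vec 2 = carrier M
     \<and> kernel_on (module_vec TYPE('r) 2) M \<pi> = (*\<^sub>v) (diff1 X) ` carrier_vec (rk1 X)
     \<and> {v \<in> carrier_vec (rk1 X). diff1 X *\<^sub>v v = 0\<^sub>v 2} = (*\<^sub>v) (diff2 X) ` carrier_vec (rk2 X)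
     \<and> {v \<in> carrier_vec (rk2 X). diff2 X *\<^sub>v v = 0\<^sub>v (rk1 X)} = (*\<^sub>v) (diff3 X) ` carrier_vec (rk3 X)
     \<and> {v \<in> carrier_vec (rk3 X). diff3 X *\<^sub>v v = 0\<^sub>v (rk2 X)} = {0\<^sub>v (rk3 X)}"

definition minimal_complex :: "'r set \<Rightarrow> 'r complex3 \<Rightarrow> bool" where
  "minimal_complex \<mm> X \<longleftrightarrow>
     elements_mat (diff1 X) \<subseteq> \<mm> \<and> elements_mat (diff2 X) \<subseteq> \<mm> \<and> elements_mat (diff3 X) \<subseteq> \<mm>"

definition homogeneous_mat ::
  "(nat \<Rightarrow> 'r::zero set) \<Rightarrow> (nat \<Rightarrow> int) \<Rightarrow> (nat \<Rightarrow> int) \<Rightarrow> 'r mat \<Rightarrow> bool" where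
  "homogeneous_mat G \<delta> \<delta>' A \<longleftrightarrow> (\<forall>i<dim_row A. \<forall>j<dim_col A.
     if \<delta> i \<le> \<delta>' j then A $$ (i, j) \<in> G (nat (\<delta>' j - \<delta> i)) else A $$ (i, j) = 0)"

definition homogeneous_complex :: "(nat \<Rightarrow> 'r::zero set) \<Rightarrow> 'r complex3 \<Rightarrow> bool" where
  "homogeneous_complex G X \<longleftrightarrow> (\<exists>\<delta>0 \<delta>1 \<delta>2 \<delta>3. homogeneous_mat G \<delta>0 \<delta>1 (diff1 X)
     \<and> homogeneous_mat G \<delta>1 \<delta>2 (diff2 X) \<and> homogeneous_mat G \<delta>2 \<delta>3 (diff3 X))"

definition minor :: "'r::comm_ring_1 complex3 \<Rightarrow> nat \<Rightarrow> nat \<Rightarrow> 'r" where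
  "minor X i j = diff1 X $$ (0, i) * diff1 X $$ (1, j) - diff1 X $$ (0, j) * diff1 X $$ (1, i)"

definition minors_ideal4 :: "'r::comm_ring_1 complex3 \<Rightarrow> 'r set" where
  "minors_ideal4 X = Idl\<^bsub>type_ring\<^esub> {minor X i j | i j. i < 4 \<and> j < 4}"


section \<open>Structure maps\<close>

text \<open>
  A structure map is given by the coordinates of its values on basis elements. A basis element
  \<open>e\<^bsub>i\<^esub> \<and> e\<^bsub>j\<^esub> \<and> \<dots>\<close> of an exterior power of \<open>F\<^sub>1\<close> is the list of its indices, in any order. The later
  arguments are, in this order: the index of a basis element of \<open>F\<^sub>2\<close> in the source; the index in \<open>F\<^sub>0\<close> of
  the target coordinate; its index in \<open>F\<^sub>2\<close>; its indices in \<open>F\<^sub>3\<close>. An element of \<open>\<And>\<^sup>2F\<^sub>3\<close> has its coordinate at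
  \<open>g\<^sub>t \<and> g\<^sub>u\<close> (for \<open>t < u\<close>) at \<open>t u\<close>; an element of \<open>S\<^sub>2F\<^sub>3\<close> has its coordinate at \<open>g\<^sub>t \<cdot> g\<^sub>u\<close>
  (for \<open>t \<le> u\<close>) at \<open>t u\<close>; other values of \<open>t u\<close> are irrelevant.
\<close>

record 'r structure_maps =
  w3_1  :: "nat list \<Rightarrow> nat \<Rightarrow> 'r"
  w2_1  :: "nat list \<Rightarrow> nat \<Rightarrow> nat \<Rightarrow> 'r"
  w1_1  :: "nat list \<Rightarrow> nat \<Rightarrow> nat \<Rightarrow> 'r"
  w3_21 :: "nat list \<Rightarrow> nat \<Rightarrow> nat \<Rightarrow> nat \<Rightarrow> 'r"
  w3_22 :: "nat list \<Rightarrow> nat \<Rightarrow> nat \<Rightarrow> 'r"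
  w2_21 :: "nat list \<Rightarrow> nat \<Rightarrow> nat \<Rightarrow> nat \<Rightarrow> nat \<Rightarrow> 'r"
  w2_22 :: "nat list \<Rightarrow> nat \<Rightarrow> nat \<Rightarrow> nat \<Rightarrow> 'r"
  w1_21 :: "nat list \<Rightarrow> nat list \<Rightarrow> nat \<Rightarrow> nat \<Rightarrow> nat \<Rightarrow> 'r"
  w1_22 :: "nat list \<Rightarrow> nat \<Rightarrow> nat \<Rightarrow> nat \<Rightarrow> nat \<Rightarrow> 'r"
  w1_3  :: "nat list \<Rightarrow> nat list \<Rightarrow> nat \<Rightarrow> nat \<Rightarrow> nat \<Rightarrow> nat \<Rightarrow> 'r"

definition index_lists :: "nat \<Rightarrow> 'r complex3 \<Rightarrow> nat list set" where
  "index_lists n X = {I. length I = n \<and> set I \<subseteq> {..<rk1 X}}"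

definition alternating :: "nat \<Rightarrow> 'r::comm_ring_1 complex3 \<Rightarrow> (nat list \<Rightarrow> 'r) \<Rightarrow> bool" where
  "alternating n X \<phi> \<longleftrightarrow> (\<forall>I\<in>index_lists n X.
     (\<not> distinct I \<longrightarrow> \<phi> I = 0)
     \<and> (\<forall>a b. a < b \<and> b < n \<longrightarrow> \<phi> (I[a := I ! b, b := I ! a]) = - \<phi> I))"

definition omit :: "nat list \<Rightarrow> nat set \<Rightarrow> nat list" where
  "omit I S = nths I (- S)"

definition half :: "'r::comm_ring_1" where
  "half = (THE c. 2 * c = 1)"

text \<open>\<open>v \<and> c\<close> for \<open>v \<in> F\<^sub>0\<close> and \<open>c \<in> F\<^sub>0 \<otimes> F\<^sub>3\<close>, and \<open>c \<and> v = - v \<and> c\<close>.\<close>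

definition wedge0 :: "(nat \<Rightarrow> 'r::comm_ring_1) \<Rightarrow> (nat \<Rightarrow> nat \<Rightarrow> 'r) \<Rightarrow> nat \<Rightarrow> 'r" where
  "wedge0 v c t = v 0 * c 1 t - v 1 * c 0 t"

definition wedge0_r :: "(nat \<Rightarrow> nat \<Rightarrow> 'r::comm_ring_1) \<Rightarrow> (nat \<Rightarrow> 'r) \<Rightarrow> nat \<Rightarrow> 'r" where
  "wedge0_r c v t = - wedge0 v c t"

definition d1 :: "'r complex3 \<Rightarrow> nat \<Rightarrow> nat \<Rightarrow> 'r" where
  "d1 X i s = diff1 X $$ (s, i)"

text \<open>
  Equality in \<open>S\<^sub>2\<close> and in \<open>\<And>\<^sup>2\<close> of a free module of rank \<open>n\<close>, of elements given by representatives in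
  the tensor square.
\<close>

definition eq_S2 :: "nat \<Rightarrow> (nat \<Rightarrow> nat \<Rightarrow> 'r::comm_ring_1) \<Rightarrow> (nat \<Rightarrow> nat \<Rightarrow> 'r) \<Rightarrow> bool" where
  "eq_S2 n P Q \<longleftrightarrow> (\<forall>h<n. P h h = Q h h)
     \<and> (\<forall>k<n. \<forall>h<k. P h k + P k h = Q h k + Q k h)"

definition eq_wedge2 :: "nat \<Rightarrow> (nat \<Rightarrow> nat \<Rightarrow> 'r::comm_ring_1) \<Rightarrow> (nat \<Rightarrow> nat \<Rightarrow> 'r) \<Rightarrow> bool" where
  "eq_wedge2 n P Q \<longleftrightarrow> (\<forall>k<n. \<forall>h<k. P h k - P k h = Q h k - Q k h)"

text \<open>The map \<open>F\<^sub>3 \<otimes> F\<^sub>2 \<rightarrow> F\<^sub>2 \<otimes> F\<^sub>2\<close> induced by \<open>d\<^sub>3\<close>, and \<open>\<iota>\<close>, \<open>\<kappa>\<close>; the coordinate of an element of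
  \<open>F\<^sub>2 \<otimes> F\<^sub>3\<close> at \<open>f\<^sub>h \<otimes> g\<^sub>v\<close> is at \<open>h v\<close>.\<close>

definition push3 :: "'r::comm_ring_1 complex3 \<Rightarrow> (nat \<Rightarrow> nat \<Rightarrow> 'r) \<Rightarrow> nat \<Rightarrow> nat \<Rightarrow> 'r" where
  "push3 X c h k = (\<Sum>t<rk3 X. c h t * diff3 X $$ (k, t))"

definition iota :: "'r::comm_ring_1 complex3 \<Rightarrow> (nat \<Rightarrow> nat \<Rightarrow> 'r) \<Rightarrow> nat \<Rightarrow> nat \<Rightarrow> 'r" where
  "iota X c h v = (\<Sum>u<rk3 X. \<Sum>t<u.
     c t u * (diff3 X $$ (h, t) * of_bool (u = v) - of_bool (t = v) * diff3 X $$ (h, u)))"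

definition kappa :: "'r::comm_ring_1 complex3 \<Rightarrow> (nat \<Rightarrow> nat \<Rightarrow> 'r) \<Rightarrow> nat \<Rightarrow> nat \<Rightarrow> 'r" where
  "kappa X c h v = (\<Sum>u<rk3 X. \<Sum>t\<le>u.
     c t u * (diff3 X $$ (h, t) * of_bool (u = v) + diff3 X $$ (h, u) * of_bool (t = v)))"

definition is_w3_1 :: "'r::comm_ring_1 complex3 \<Rightarrow> 'r structure_maps \<Rightarrow> bool" where
  "is_w3_1 X w \<longleftrightarrow> (\<forall>h<rk2 X. alternating 3 X (\<lambda>I. w3_1 w I h))
     \<and> (\<forall>i<rk1 X. \<forall>j<rk1 X. \<forall>k<rk1 X. \<forall>q<rk1 X.
          (\<Sum>h<rk2 X. diff2 X $$ (q, h) * w3_1 w [i, j, k] h)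
          = minor X i j * of_bool (q = k) - minor X i k * of_bool (q = j) + minor X j k * of_bool (q = i))"

definition is_w2_1 :: "'r::comm_ring_1 complex3 \<Rightarrow> 'r structure_maps \<Rightarrow> bool" where
  "is_w2_1 X w \<longleftrightarrow> (\<forall>h<rk2 X. \<forall>t<rk3 X. alternating 2 X (\<lambda>I. w2_1 w I h t))
     \<and> (\<forall>i<rk1 X. \<forall>j<rk1 X. \<forall>h<rk2 X. \<forall>q<rk2 X.
          (\<Sum>t<rk3 X. diff3 X $$ (q, t) * w2_1 w [i, j] h t)
          = minor X i j * of_bool (q = h) - (\<Sum>k<rk1 X. diff2 X $$ (k, h) * w3_1 w [k, i, j] q))"

definition is_w1_1 :: "'r::comm_ring_1 complex3 \<Rightarrow> 'r structure_maps \<Rightarrow> bool" where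
  "is_w1_1 X w \<longleftrightarrow> (\<forall>s<2. \<forall>t<rk3 X. alternating 4 X (\<lambda>I. w1_1 w I s t))
     \<and> (\<forall>I\<in>index_lists 4 X. \<forall>s<2. \<forall>q<rk2 X.
          (\<Sum>t<rk3 X. diff3 X $$ (q, t) * w1_1 w I s t)
          = (\<Sum>j<4. (- 1) ^ j * d1 X (I ! j) s * w3_1 w (omit I {j}) q))"

text \<open>
  The sign in front of the lifted element is the one for which the first formula for \<open>w\<^sup>(\<^sup>2\<^sup>)\<^bsub>2,1\<^esub>\<close> below can be
  lifted (its image in \<open>S\<^sub>2F\<^sub>2\<close> must vanish).
\<close>

definition is_w3_21 :: "'r::comm_ring_1 complex3 \<Rightarrow> 'r structure_maps \<Rightarrow> bool" where
  "is_w3_21 X w \<longleftrightarrow>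
     (\<forall>a<rk1 X. \<forall>h<rk2 X. \<forall>t<rk3 X. alternating 5 X (\<lambda>I. w3_21 w I a h t))
     \<and> (\<forall>I\<in>index_lists 5 X. eq_S2 (rk2 X)
          (push3 X (w3_21 w I (I ! 0)))
          (\<lambda>h k. - (w3_1 w [I ! 0, I ! 1, I ! 2] h * w3_1 w [I ! 0, I ! 3, I ! 4] k
                  - w3_1 w [I ! 0, I ! 1, I ! 3] h * w3_1 w [I ! 0, I ! 2, I ! 4] k
                  + w3_1 w [I ! 0, I ! 1, I ! 4] h * w3_1 w [I ! 0, I ! 2, I ! 3] k)))"

text \<open>
  Lifted along \<open>F\<^sub>3 \<otimes> F\<^sub>2 \<rightarrow> \<And>\<^sup>2F\<^sub>2\<close>: modulo \<open>S\<^sub>2F\<^sub>2\<close> in place of \<open>\<And>\<^sup>2F\<^sub>2\<close> the element is not skew-symmetric in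
  \<open>e\<^sub>1, \<dots>, e\<^sub>6\<close>, while the condition for lifting along \<open>\<kappa>\<close>, as needed for \<open>w\<^sup>(\<^sup>2\<^sup>)\<^bsub>2,2\<^esub>\<close> and \<open>w\<^sup>(\<^sup>1\<^sup>)\<^bsub>2,2\<^esub>\<close>, is
  the vanishing of the image in \<open>\<And>\<^sup>2F\<^sub>2\<close>. If the rank of \<open>F\<^sub>1\<close> is 5 then the map is 0.
\<close>

definition is_w3_22 :: "'r::comm_ring_1 complex3 \<Rightarrow> 'r structure_maps \<Rightarrow> bool" where
  "is_w3_22 X w \<longleftrightarrow>
     (\<forall>h<rk2 X. \<forall>t<rk3 X. alternating 6 X (\<lambda>I. w3_22 w I h t))
     \<and> (\<forall>I\<in>index_lists 6 X. eq_wedge2 (rk2 X)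
          (push3 X (w3_22 w I))
          (\<lambda>h k. \<Sum>j<5. \<Sum>i<j. (- 1) ^ (i + j + 1)
              * w3_1 w [I ! i, I ! j, I ! 5] h * w3_1 w (omit I {i, j, 5}) k))"

text \<open>
  The second formula, for five distinct indices, is only needed when \<open>F\<^sub>1\<close> has rank 5. Its right-hand side
  is the element which can be lifted along \<open>\<iota>\<close> and for which \<open>w\<^sup>(\<^sup>3\<^sup>)\<^bsub>2,2\<^esub>(\<sigma> \<and> \<gamma>\<^sub>1 \<and> \<gamma>\<^sub>2)\<close> of the linked complex, below,
  is a lift; for \<open>e\<^sub>5 = e\<^sub>1\<close> it specializes to that of the first formula.
\<close>

definition is_w2_21 :: "'r::comm_ring_1 complex3 \<Rightarrow> 'r structure_maps \<Rightarrow> bool" where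
  "is_w2_21 X w \<longleftrightarrow>
     (\<forall>a<rk1 X. \<forall>h<rk2 X. \<forall>u<rk3 X. \<forall>t<u. alternating 4 X (\<lambda>I. w2_21 w I a h t u))
     \<and> (\<forall>I\<in>index_lists 4 X. \<forall>h<rk2 X. \<forall>q<rk2 X. \<forall>v<rk3 X.
          iota X (w2_21 w I (I ! 0) h) q v
          = w3_1 w [I ! 0, I ! 1, I ! 2] q * w2_1 w [I ! 0, I ! 3] h v
            - w3_1 w [I ! 0, I ! 1, I ! 3] q * w2_1 w [I ! 0, I ! 2] h v
            + w3_1 w [I ! 0, I ! 2, I ! 3] q * w2_1 w [I ! 0, I ! 1] h v
            + of_bool (q = h) * wedge0 (d1 X (I ! 0)) (w1_1 w I) v
            - (\<Sum>k<rk1 X. diff2 X $$ (k, h) * w3_21 w (I @ [k]) (I ! 0) q v))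
     \<and> (rk1 X = 5 \<longrightarrow> (\<forall>J\<in>index_lists 5 X. distinct J \<longrightarrow> (\<forall>h<rk2 X. \<forall>q<rk2 X. \<forall>v<rk3 X.
          iota X (w2_21 w (take 4 J) (J ! 4) h) q v
          = (\<Sum>j<4. \<Sum>i<j. (- 1) ^ (i + j + 1)
               * w2_1 w (omit J {i, j, 4}) h v * w3_1 w [J ! i, J ! j, J ! 4] q)
            + half * of_bool (q = h)
               * ((\<Sum>i<4. (- 1) ^ i * wedge0_r (w1_1 w (omit J {i})) (d1 X (J ! i)) v)
                  - wedge0_r (w1_1 w (omit J {4})) (d1 X (J ! 4)) v)
            - (\<Sum>k<rk1 X. diff2 X $$ (k, h)
               * (w3_21 w (take 4 J @ [k]) (J ! 4) q v + w3_21 w J k q v)))))"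

text \<open>
  The order of the factors in \<open>w\<^sup>(\<^sup>1\<^sup>)\<^sub>1(\<dots>) \<and> d\<^sub>1(e\<^sub>i)\<close> is the one for which the multiples of \<open>f\<^sub>h\<close> cancel in \<open>\<And>\<^sup>2F\<^sub>2\<close>,
  so that the element can be lifted along \<open>\<kappa>\<close>.
\<close>

definition is_w2_22 :: "'r::comm_ring_1 complex3 \<Rightarrow> 'r structure_maps \<Rightarrow> bool" where
  "is_w2_22 X w \<longleftrightarrow>
     (\<forall>h<rk2 X. \<forall>u<rk3 X. \<forall>t\<le>u. alternating 5 X (\<lambda>I. w2_22 w I h t u))
     \<and> (\<forall>I\<in>index_lists 5 X. \<forall>h<rk2 X. \<forall>q<rk2 X. \<forall>v<rk3 X.
          kappa X (w2_22 w I h) q v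
          = (\<Sum>k<5. \<Sum>j<k. \<Sum>i<j. (- 1) ^ (i + j + k + 1)
               * w3_1 w [I ! i, I ! j, I ! k] q * w2_1 w (omit I {i, j, k}) h v)
            + half * of_bool (q = h)
               * (\<Sum>i<5. (- 1) ^ (i + 1) * wedge0_r (w1_1 w (omit I {i})) (d1 X (I ! i)) v)
            - (\<Sum>k<rk1 X. diff2 X $$ (k, h) * w3_22 w (I @ [k]) q v))"

text \<open>The sign of the second sum corresponds to the sign in \<^const>\<open>is_w3_21\<close>.\<close>

definition is_w1_21 :: "'r::comm_ring_1 complex3 \<Rightarrow> 'r structure_maps \<Rightarrow> bool" where
  "is_w1_21 X w \<longleftrightarrow>
     (\<forall>J\<in>index_lists 2 X. \<forall>s<2. \<forall>u<rk3 X. \<forall>t<u. alternating 5 X (\<lambda>I. w1_21 w I J s t u))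
     \<and> (\<forall>I\<in>index_lists 5 X. \<forall>s<2. \<forall>u<rk3 X. \<forall>t<u. alternating 2 X (\<lambda>J. w1_21 w I J s t u))
     \<and> (\<forall>I\<in>index_lists 5 X. \<forall>s<2. \<forall>q<rk2 X. \<forall>v<rk3 X.
          iota X (w1_21 w I [I ! 0, I ! 1] s) q v
          = (\<Sum>i\<in>{2..<5}. (- 1) ^ i * w3_1 w [I ! 0, I ! 1, I ! i] q * w1_1 w (omit I {i}) s v)
            + (\<Sum>j<2. (- 1) ^ j * d1 X (I ! j) s * w3_21 w I (I ! (1 - j)) q v))"

definition is_w1_22 :: "'r::comm_ring_1 complex3 \<Rightarrow> 'r structure_maps \<Rightarrow> bool" where
  "is_w1_22 X w \<longleftrightarrow>
     (\<forall>a<rk1 X. \<forall>s<2. \<forall>u<rk3 X. \<forall>t\<le>u. alternating 6 X (\<lambda>I. w1_22 w I a s t u))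
     \<and> (\<forall>I\<in>index_lists 6 X. \<forall>s<2. \<forall>q<rk2 X. \<forall>v<rk3 X.
          kappa X (w1_22 w I (I ! 0) s) q v
          = (\<Sum>j\<in>{1..<6}. \<Sum>i\<in>{1..<j}. (- 1) ^ (i + j + 1)
               * w3_1 w [I ! 0, I ! i, I ! j] q * w1_1 w (omit I {i, j}) s v)
            + d1 X (I ! 0) s * w3_22 w I q v)"

text \<open>
  As tensor factors are reordered freely, the two factors \<open>F\<^sub>3\<close> of \<open>F\<^sub>3 \<otimes> F\<^sub>3 \<otimes> F\<^sub>2\<close> are not distinguished:
  the lift is along \<open>\<And>\<^sup>2F\<^sub>3 \<otimes> F\<^sub>3 \<rightarrow> S\<^sub>2F\<^sub>3 \<otimes> F\<^sub>2\<close>.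
\<close>

definition is_w1_3 :: "'r::comm_ring_1 complex3 \<Rightarrow> 'r structure_maps \<Rightarrow> bool" where
  "is_w1_3 X w \<longleftrightarrow>
     (\<forall>J\<in>index_lists 5 X. \<forall>s<2. \<forall>u<rk3 X. \<forall>t<u. \<forall>v<rk3 X. alternating 5 X (\<lambda>I. w1_3 w I J s t u v))
     \<and> (\<forall>I\<in>index_lists 5 X. \<forall>s<2. \<forall>u<rk3 X. \<forall>t<u. \<forall>v<rk3 X. alternating 5 X (\<lambda>J. w1_3 w I J s t u v))
     \<and> (\<forall>I\<in>index_lists 5 X. \<forall>s<2. \<forall>q<rk2 X. eq_S2 (rk3 X)
          (\<lambda>v v'. iota X (\<lambda>t u. w1_3 w I I s t u v') q v)
          (\<lambda>v v'. \<Sum>i<5. (- 1) ^ i * w1_1 w (omit I {i}) s v * w3_21 w I (I ! i) q v'))"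

definition structure_maps_of :: "'r::comm_ring_1 complex3 \<Rightarrow> 'r structure_maps \<Rightarrow> bool" where
  "structure_maps_of X w \<longleftrightarrow> is_w3_1 X w \<and> is_w2_1 X w \<and> is_w1_1 X w \<and> is_w3_21 X w \<and> is_w3_22 X w
     \<and> is_w2_21 X w \<and> is_w2_22 X w
     \<and> (rk1 X = 5 \<longrightarrow> is_w1_21 X w \<and> is_w1_3 X w) \<and> (rk1 X = 6 \<longrightarrow> is_w1_22 X w)"


section \<open>The linked complex\<close>

text \<open>
  The mapping cone with \<open>A\<^sub>1\<^sup>*\<close> and \<open>A\<^sub>2\<^sup>* \<oplus> B\<^sub>2\<close> in degrees 3 and 2, after removal of
  \<open>\<epsilon>\<^sub>1, \<dots>, \<epsilon>\<^sub>4\<close> against \<open>t\<^sub>1, \<dots>, t\<^sub>4\<close>. The bases are \<open>\<gamma>\<^sub>1, \<dots>, s\<^sub>1, \<dots>, s\<^sub>4\<close> in degree 1,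
  \<open>\<phi>\<^sub>1, \<dots>\<close> in degree 2, and \<open>\<epsilon>\<^sub>5, \<dots>\<close> in degree 3, in this order; so \<open>\<gamma>\<^sub>1\<close>, \<open>\<phi>\<^sub>1\<close> and \<open>\<epsilon>\<^sub>5\<close> have index 0,
  and \<open>s\<^sub>1\<close> has index \<^term>\<open>rk3 A\<close>.
\<close>

definition beta2 :: "'r::comm_ring_1 structure_maps \<Rightarrow> nat \<Rightarrow> nat \<Rightarrow> 'r" where
  "beta2 w i h = (- 1) ^ i * w3_1 w (omit [0, 1, 2, 3] {i}) h"

definition beta3 :: "'r::comm_ring_1 structure_maps \<Rightarrow> nat \<Rightarrow> nat \<Rightarrow> 'r" where
  "beta3 w j t = w1_1 w [0, 1, 2, 3] j t"

definition linked_complex :: "'r::comm_ring_1 complex3 \<Rightarrow> 'r structure_maps \<Rightarrow> 'r complex3" where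
  "linked_complex A w = \<lparr>
     diff1 = mat 2 (rk3 A + 4) (\<lambda>(j, c). if c < rk3 A then beta3 w j c else diff1 A $$ (j, c - rk3 A)),
     diff2 = mat (rk3 A + 4) (rk2 A)
       (\<lambda>(c, h). if c < rk3 A then diff3 A $$ (h, c) else - beta2 w (c - rk3 A) h),
     diff3 = mat (rk2 A) (rk1 A - 4) (\<lambda>(h, k). diff2 A $$ (k + 4, h))\<rparr>"

abbreviation sidx :: "'r complex3 \<Rightarrow> nat \<Rightarrow> nat" where "sidx A i \<equiv> rk3 A + i"

abbreviation sigma :: "'r complex3 \<Rightarrow> nat list" where "sigma A \<equiv> map (sidx A) [0, 1, 2, 3]"

text \<open>
  The image of \<open>t\<^sub>r\<close> in degree 2 of the reduced complex: the removed element
  \<open>d\<^sub>3(\<epsilon>\<^sub>r) = \<Sum>\<^sub>h y\<^bsub>rh\<^esub> \<phi>\<^sub>h + t\<^sub>r\<close> becomes 0.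
\<close>

definition tvec :: "'r::comm_ring_1 complex3 \<Rightarrow> nat \<Rightarrow> nat \<Rightarrow> 'r" where
  "tvec A r h = - diff2 A $$ (r, h)"

text \<open>
  The choice of lower structure maps \<open>v\<close> of the linked complex in terms of the structure maps \<open>w\<close> of \<open>A\<close>.
  The signs of the values on \<open>s\<^sub>i \<and> \<gamma>\<^sub>t \<and> \<gamma>\<^sub>u\<close>, \<open>s\<^sub>i \<and> s\<^sub>j \<and> s\<^sub>k \<and> \<gamma>\<^sub>t\<close> and \<open>\<sigma> \<and> \<gamma>\<^sub>t \<and> \<gamma>\<^sub>u\<close> are the ones for
  which these are lifts of the required elements with respect to the differentials of \<^const>\<open>linked_complex\<close>.
\<close>

definition lower_maps :: "'r::comm_ring_1 complex3 \<Rightarrow> 'r structure_maps \<Rightarrow> 'r structure_maps \<Rightarrow> bool" where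
  "lower_maps A w v \<longleftrightarrow>
     (\<forall>i j k r h. i < j \<and> j < k \<and> k < 4 \<and> r < 4 \<and> r \<notin> {i, j, k} \<and> h < rk2 A \<longrightarrow>
        w3_1 v [sidx A i, sidx A j, sidx A k] h = (- 1) ^ (r + 1) * tvec A r h)
     \<and> (\<forall>i<4. \<forall>j<4. \<forall>t<rk3 A. \<forall>h<rk2 A.
        w3_1 v [sidx A i, sidx A j, t] h = w2_1 w [i, j] h t)
     \<and> (\<forall>i<4. \<forall>u<rk3 A. \<forall>t<u. \<forall>h<rk2 A.
        w3_1 v [sidx A i, t, u] h = - w2_21 w [0, 1, 2, 3] i h t u)
     \<and> (\<forall>i<4. \<forall>j<4. \<forall>l<4. \<forall>t<rk3 A. \<forall>s<2. \<forall>k\<in>{4..<rk1 A}.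
        w1_1 v [sidx A i, sidx A j, sidx A l, t] s (k - 4) = - w1_1 w [i, j, l, k] s t)
     \<and> (\<forall>i<4. \<forall>j<4. \<forall>u<rk3 A. \<forall>t<u. \<forall>s<2. \<forall>k\<in>{4..<rk1 A}.
        w1_1 v [sidx A i, sidx A j, t, u] s (k - 4) = w1_21 w [0, 1, 2, 3, k] [i, j] s t u)
     \<and> (\<forall>j<4. \<forall>t<rk3 A. \<forall>h<rk2 A. \<forall>k\<in>{4..<rk1 A}.
        w3_21 v (sigma A @ [t]) (sidx A j) h (k - 4) = w2_1 w [k, j] h t)
     \<and> (\<forall>t<rk3 A. \<forall>h<rk2 A. \<forall>k\<in>{4..<rk1 A}.
        w3_21 v (sigma A @ [t]) t h (k - 4) = w2_22 w [0, 1, 2, 3, k] h t t)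
     \<and> (\<forall>u<rk3 A. \<forall>t<u. \<forall>h<rk2 A. \<forall>k\<in>{4..<rk1 A}.
        w3_22 v (sigma A @ [t, u]) h (k - 4) = - w2_21 w [0, 1, 2, 3] k h t u)"

end

theory Submission
  imports Defs "HOL-Combinatorics.Transposition"
begin

text \<open>
  Of the two resolutions only \<open>d\<^sub>1d\<^sub>2 = 0\<close> and the injectivity of \<open>d\<^sub>3\<close> matter, together with
  the invertibility of 2. Injectivity allows one to check an identity after multiplication by the entries of
  \<open>d\<^sub>3\<close>, where the defining equations of the structure maps apply. For any lifts this gives
  two relations: the contraction of \<open>d\<^sub>1\<close> with \<open>w\<^sup>(\<^sup>2\<^sup>)\<^sub>1\<close> over three basis elements equals the contraction of
  \<open>d\<^sub>2\<close> with \<open>w\<^sup>(\<^sup>1\<^sup>)\<^sub>1\<close>, and the contraction of \<open>d\<^sub>1\<close> with \<open>w\<^sup>(\<^sup>1\<^sup>)\<^sub>1\<close> over five basis elements is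
  skew-symmetric in \<open>F\<^sub>0 \<otimes> F\<^sub>0\<close>.

  The matrix of \<open>d\<^sub>3\<close> of the linked complex consists of rows of the matrix of \<open>a\<^sub>2\<close>. Hence the element which the higher
  map of the linked complex lifts is, by the formulas for the lower maps, an expression in the lower maps of
  \<open>\<A>\<close>, and one has to see that it is the corresponding row of \<open>a\<^sub>2\<close> times the higher map of
  \<open>\<A>\<close>. Multiplied by \<open>a\<^sub>3\<close> this becomes a polynomial identity modulo the two relations.
\<close>

section \<open>Alternating maps and exactness\<close>

lemma sum_lessThan_small:
  fixes f :: "nat \<Rightarrow> 'a::comm_monoid_add"
  shows "(\<Sum>k<0. f k) = 0"
    "(\<Sum>k<1. f k) = f 0"
    "(\<Sum>k<2. f k) = f 0 + f 1"
    "(\<Sum>k<3. f k) = f 0 + f 1 + f 2"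
    "(\<Sum>k<4. f k) = f 0 + f 1 + f 2 + f 3"
    "(\<Sum>k<5. f k) = f 0 + f 1 + f 2 + f 3 + f 4"
    "(\<Sum>k<6. f k) = f 0 + f 1 + f 2 + f 3 + f 4 + f 5"
  by (simp_all add: eval_nat_numeral)

text \<open>The long polynomial identities below are checked in stages: distribute with these rules,
  order the factors with \<open>mult_ac\<close>, cancel. \<open>mult_2\<close> splits a doubled term
  so that its halves can cancel separately.\<close>

lemmas ring_expand = ring_distribs mult_minus_left mult_minus_right minus_minus mult_2 mult_1_left

lemma alternating_swap:
  assumes "alternating n X \<phi>" "xs @ a # b # ys \<in> index_lists n X"
  shows "\<phi> (xs @ b # a # ys) = - \<phi> (xs @ a # b # ys)"
proof -
  let ?I = "xs @ a # b # ys" and ?m = "length xs"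
  have "?m < Suc ?m" "Suc ?m < n" using assms(2) by (auto simp: index_lists_def)
  moreover have "?I[?m := ?I ! Suc ?m, Suc ?m := ?I ! ?m] = xs @ b # a # ys"
    by (simp add: nth_append list_update_append)
  ultimately show ?thesis using assms unfolding alternating_def by metis
qed

lemma alternating_repeat:
  assumes "alternating n X \<phi>" "I \<in> index_lists n X" "\<not> distinct I"
  shows "\<phi> I = 0"
  using assms unfolding alternating_def by blast

lemma alternating_4_swap:
  assumes "alternating 4 X \<phi>" "a < rk1 X" "b < rk1 X" "c < rk1 X" "d < rk1 X"
  shows "\<phi> [b, a, c, d] = - \<phi> [a, b, c, d]" "\<phi> [a, c, b, d] = - \<phi> [a, b, c, d]"
    "\<phi> [a, b, d, c] = - \<phi> [a, b, c, d]"
  using alternating_swap[OF assms(1), of "[]" a b "[c, d]"] alternating_swap[OF assms(1), of "[a]" b c "[d]"]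
    alternating_swap[OF assms(1), of "[a, b]" c d "[]"] assms(2-)
  by (simp_all add: index_lists_def)

lemma alternating_5_swap:
  assumes "alternating 5 X \<phi>" "a < rk1 X" "b < rk1 X" "c < rk1 X" "d < rk1 X" "e < rk1 X"
  shows "\<phi> [b, a, c, d, e] = - \<phi> [a, b, c, d, e]" "\<phi> [a, c, b, d, e] = - \<phi> [a, b, c, d, e]"
    "\<phi> [a, b, d, c, e] = - \<phi> [a, b, c, d, e]" "\<phi> [a, b, c, e, d] = - \<phi> [a, b, c, d, e]"
  using alternating_swap[OF assms(1), of "[]" a b "[c, d, e]"] alternating_swap[OF assms(1), of "[a]" b c "[d, e]"]
    alternating_swap[OF assms(1), of "[a, b]" c d "[e]"] alternating_swap[OF assms(1), of "[a, b, c]" d e "[]"]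
    assms(2-)
  by (simp_all add: index_lists_def)

text \<open>Several defining equations single out the first index of a list. Exchanging the
  positions 0 and \<open>i\<close> reduces the other entries to these; for \<open>i = 0\<close>
  nothing moves, hence the sign 1.\<close>

lemma alternating_transpose:
  assumes "alternating n X \<phi>" "I \<in> index_lists n X" "i < n"
  shows "\<phi> (I[0 := I ! i, i := I ! 0]) = (if i = 0 then 1 else - 1) * \<phi> I"
proof (cases "i = 0")
  case False
  then show ?thesis
    using assms(1)[unfolded alternating_def, THEN bspec, OF assms(2), THEN conjunct2, rule_format, of 0 i] assms(3)
    by simp
qed simp

text \<open>The last index passes three others. This turns \<sigma> followed by a \<gamma> into a
  list beginning with an s and the \<gamma>, as the defining equation of \<open>w1_21\<close>
  requires.\<close>

lemma alternating_5_cycle: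
  assumes "alternating 5 X \<phi>" "a < rk1 X" "b < rk1 X" "c < rk1 X" "d < rk1 X" "e < rk1 X"
  shows "\<phi> [a, e, b, c, d] = - \<phi> [a, b, c, d, e]"
  using alternating_5_swap(2)[OF assms(1), of a b e c d] alternating_5_swap(3)[OF assms(1), of a b c e d]
    alternating_5_swap(4)[OF assms(1), of a b c d e] assms(2-) by simp

text \<open>A pair passes four indices by eight transpositions, so no sign appears; in this way the
  two \<gamma> are put in front of \<sigma>.\<close>

lemma alternating_6_cycle:
  assumes "alternating 6 X \<phi>" "{a, b, c, d, e, f} \<subseteq> {..<rk1 X}"
  shows "\<phi> [a, b, c, d, e, f] = \<phi> [c, d, e, f, a, b]" "\<phi> [a, b, c, d, f, e] = - \<phi> [a, b, c, d, e, f]"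
proof -
  note swap = alternating_swap[OF assms(1)]
  have "\<phi> [a, b, c, d, e, f] = \<phi> [a, c, d, e, f, b]"
    using swap[of "[a]" c b "[d, e, f]"] swap[of "[a, c]" d b "[e, f]"] swap[of "[a, c, d]" e b "[f]"]
      swap[of "[a, c, d, e]" f b "[]"] assms(2) by (simp add: index_lists_def)
  also have "\<dots> = \<phi> [c, d, e, f, a, b]"
    using swap[of "[]" c a "[d, e, f, b]"] swap[of "[c]" d a "[e, f, b]"] swap[of "[c, d]" e a "[f, b]"]
      swap[of "[c, d, e]" f a "[b]"] assms(2) by (simp add: index_lists_def)
  finally show "\<phi> [a, b, c, d, e, f] = \<phi> [c, d, e, f, a, b]" .
  show "\<phi> [a, b, c, d, f, e] = - \<phi> [a, b, c, d, e, f]"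
    using swap[of "[a, b, c, d]" e f "[]"] assms(2) by (simp add: index_lists_def)
qed

text \<open>\<open>half\<close> is a definite description, so its value is known only after the
  inverse of 2 has been seen to be unique: a second inverse c' satisfies c' = c' (2 c) = c.\<close>

lemma half_double:
  fixes r :: "'r::comm_ring_1"
  assumes "(2 :: 'r) dvd 1"
  shows "half * (2 * r) = r" "2 * (half * r) = r" "half * (r + r) = r"
proof -
  from assms obtain c :: 'r where c: "2 * c = 1" by (metis dvdE)
  have "c' = c" if "2 * c' = 1" for c' :: 'r
  proof -
    have "c' = c' * (2 * c)" using c by simp
    also have "\<dots> = (2 * c') * c" by (simp only: mult_ac)
    finally show ?thesis using that by simp
  qed
  with c have "2 * half = (1 :: 'r)"
    unfolding half_def by (rule_tac theI2[where P = "\<lambda>c. 2 * c = 1"]) auto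
  then show "2 * (half * r) = r" by (simp add: mult.assoc[symmetric])
  then show "half * (2 * r) = r" by (simp only: mult.left_commute)
  then show "half * (r + r) = r" by (simp only: mult_2)
qed

text \<open>Coordinate form of the two facts kept from a resolution. Since \<open>u\<close> is an
  arbitrary function on indices, constant families and families supported at one index can be
  inserted directly.\<close>

definition exact_tail :: "'r::comm_ring_1 complex3 \<Rightarrow> bool" where
  "exact_tail X \<longleftrightarrow> (\<forall>s<2. \<forall>h<rk2 X. (\<Sum>k<rk1 X. d1 X k s * diff2 X $$ (k, h)) = 0)
     \<and> (\<forall>u. (\<forall>q<rk2 X. (\<Sum>t<rk3 X. diff3 X $$ (q, t) * u t) = 0) \<longrightarrow> (\<forall>t<rk3 X. u t = 0))"

lemma free_resolution_exact_tail:
  assumes "free_resolution X M \<pi>"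
  shows "exact_tail X"
  unfolding exact_tail_def
proof safe
  have dims: "dim_row (diff1 X) = 2" "dim_row (diff2 X) = rk1 X" "dim_row (diff3 X) = rk2 X"
    and ex1: "{v \<in> carrier_vec (rk1 X). diff1 X *\<^sub>v v = 0\<^sub>v 2} = (*\<^sub>v) (diff2 X) ` carrier_vec (rk2 X)"
    and ex3: "{v \<in> carrier_vec (rk3 X). diff3 X *\<^sub>v v = 0\<^sub>v (rk2 X)} = {0\<^sub>v (rk3 X)}"
    using assms unfolding free_resolution_def by auto
  fix s h :: nat assume s: "s < 2" and h: "h < rk2 X"
  \<comment> \<open>The relation between \<open>diff1\<close> and \<open>diff2\<close> is tested on
    the basis vector f_h, whose image is column \<open>h\<close> of \<open>diff2\<close>.\<close>
  have "diff2 X *\<^sub>v unit_vec (rk2 X) h \<in> (*\<^sub>v) (diff2 X) ` carrier_vec (rk2 X)" by auto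
  then have "diff1 X *\<^sub>v (diff2 X *\<^sub>v unit_vec (rk2 X) h) = 0\<^sub>v 2" using ex1 by blast
  moreover have "diff2 X *\<^sub>v unit_vec (rk2 X) h = col (diff2 X) h"
    using h by (intro eq_vecI) (auto simp: scalar_prod_right_unit)
  ultimately have "(diff1 X *\<^sub>v col (diff2 X) h) $ s = 0" using s by simp
  then show "(\<Sum>k<rk1 X. d1 X k s * diff2 X $$ (k, h)) = 0"
    using s h dims by (simp add: d1_def scalar_prod_def atLeast0LessThan)
next
  have dims: "dim_row (diff1 X) = 2" "dim_row (diff2 X) = rk1 X" "dim_row (diff3 X) = rk2 X"
    and ex3: "{v \<in> carrier_vec (rk3 X). diff3 X *\<^sub>v v = 0\<^sub>v (rk2 X)} = {0\<^sub>v (rk3 X)}"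
    using assms unfolding free_resolution_def by auto
  fix u t assume u: "\<forall>q<rk2 X. (\<Sum>t<rk3 X. diff3 X $$ (q, t) * u t) = 0" and t: "t < rk3 X"
  have "diff3 X *\<^sub>v vec (rk3 X) u = 0\<^sub>v (rk2 X)"
  proof (rule eq_vecI)
    fix q assume "q < dim_vec (0\<^sub>v (rk2 X) :: 'a vec)"
    then show "(diff3 X *\<^sub>v vec (rk3 X) u) $ q = 0\<^sub>v (rk2 X) $ q"
      using u dims by (simp add: scalar_prod_def atLeast0LessThan)
  qed (use dims in simp)
  then have "vec (rk3 X) u \<in> {v \<in> carrier_vec (rk3 X). diff3 X *\<^sub>v v = 0\<^sub>v (rk2 X)}" by simp
  then have "vec (rk3 X) u = 0\<^sub>v (rk3 X)" unfolding ex3 by simp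
  then show "u t = 0" using t by (metis index_vec index_zero_vec(1))
qed

text \<open>The form in which injectivity is applied: an identity in F_3 is checked on the
  coordinates of its image in F_2, where the lifting equations are available.\<close>

lemma exact_tail_inj:
  assumes "exact_tail X" "t < rk3 X"
    and "\<And>q. q < rk2 X \<Longrightarrow> (\<Sum>t<rk3 X. diff3 X $$ (q, t) * u t) = (\<Sum>t<rk3 X. diff3 X $$ (q, t) * u' t)"
  shows "u t = u' t"
proof -
  have "\<forall>q<rk2 X. (\<Sum>t<rk3 X. diff3 X $$ (q, t) * (u t - u' t)) = 0"
    using assms(3) by (simp add: right_diff_distrib sum_subtractf)
  then have "u t - u' t = 0"
    using conjunct2[OF assms(1)[unfolded exact_tail_def], rule_format, of "\<lambda>t. u t - u' t"] assms(2) by simp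
  then show ?thesis by simp
qed

section \<open>Relations between the structure maps of a resolution\<close>

lemma w1_1_eq:
  assumes "is_w1_1 X w" "a < rk1 X" "b < rk1 X" "c < rk1 X" "d < rk1 X" "s < 2" "p < rk2 X"
  shows "(\<Sum>t<rk3 X. diff3 X $$ (p, t) * w1_1 w [a, b, c, d] s t)
    = d1 X a s * w3_1 w [b, c, d] p - d1 X b s * w3_1 w [a, c, d] p
      + d1 X c s * w3_1 w [a, b, d] p - d1 X d s * w3_1 w [a, b, c] p"
proof -
  have "[a, b, c, d] \<in> index_lists 4 X" using assms by (simp add: index_lists_def)
  then have "(\<Sum>t<rk3 X. diff3 X $$ (p, t) * w1_1 w [a, b, c, d] s t)
    = (\<Sum>j<4. (- 1) ^ j * d1 X ([a, b, c, d] ! j) s * w3_1 w (omit [a, b, c, d] {j}) p)"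
    using assms unfolding is_w1_1_def by blast
  then show ?thesis by (simp add: sum_lessThan_small omit_def nths_Cons)
qed

lemma w2_1_eq:
  assumes "is_w2_1 X w" "a < rk1 X" "b < rk1 X" "q < rk2 X" "p < rk2 X"
  shows "(\<Sum>t<rk3 X. diff3 X $$ (p, t) * w2_1 w [a, b] q t)
    = minor X a b * of_bool (p = q) - (\<Sum>k<rk1 X. diff2 X $$ (k, q) * w3_1 w [k, a, b] p)"
  using assms unfolding is_w2_1_def by blast

text \<open>After applying \<open>diff3\<close>, the minors contributed by \<open>w2_1\<close>
  cancel by a Pluecker relation, and the rest completes to the four terms of \<open>w1_1\<close>
  because consecutive differentials compose to zero.\<close>

lemma d1_w2_1:
  assumes X: "exact_tail X" and w2: "is_w2_1 X w" and w1: "is_w1_1 X w"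
    and i: "i < rk1 X" and j: "j < rk1 X" and k: "k < rk1 X"
    and s: "s < 2" and q: "q < rk2 X" and t: "t < rk3 X"
  shows "d1 X i s * w2_1 w [j, k] q t - d1 X j s * w2_1 w [i, k] q t + d1 X k s * w2_1 w [i, j] q t
    = (\<Sum>l<rk1 X. diff2 X $$ (l, q) * w1_1 w [l, i, j, k] s t)"
proof (rule exact_tail_inj[OF X t])
  fix p assume p: "p < rk2 X"
  let ?z = "\<lambda>t. diff3 X $$ (p, t)" and ?y = "\<lambda>l. diff2 X $$ (l, q)" and ?x = "\<lambda>i. d1 X i s"
    and ?W = "\<lambda>I. w3_1 w I p"
  have yx: "(\<Sum>l<rk1 X. ?y l * (?x l * r)) = 0" for r
  proof -
    have "(\<Sum>l<rk1 X. ?x l * ?y l) = 0" using X s q unfolding exact_tail_def by blast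
    then show ?thesis by (metis (no_types, lifting) mult.assoc mult.commute mult_zero_left sum.cong sum_distrib_right)
  qed
  \<comment> \<open>Expansion of a 3x3 determinant in which row \<open>s\<close> of
    \<open>diff1\<close> occurs twice.\<close>
  have pluecker: "?x i * minor X j k - ?x j * minor X i k + ?x k * minor X i j = 0"
    using s by (auto simp: less_2_cases_iff minor_def d1_def algebra_simps)
  have "(\<Sum>t<rk3 X. ?z t * (?x i * w2_1 w [j, k] q t - ?x j * w2_1 w [i, k] q t + ?x k * w2_1 w [i, j] q t))
    = ?x i * (\<Sum>t<rk3 X. ?z t * w2_1 w [j, k] q t) - ?x j * (\<Sum>t<rk3 X. ?z t * w2_1 w [i, k] q t)
      + ?x k * (\<Sum>t<rk3 X. ?z t * w2_1 w [i, j] q t)"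
    unfolding sum_distrib_left sum.distrib[symmetric] sum_subtractf[symmetric]
    by (intro sum.cong refl) (simp only: ring_distribs, simp only: mult_ac)
  also have "\<dots> = (?x i * minor X j k - ?x j * minor X i k + ?x k * minor X i j) * of_bool (p = q)
      - (\<Sum>l<rk1 X. ?y l * (?x i * ?W [l, j, k] - ?x j * ?W [l, i, k] + ?x k * ?W [l, i, j]))"
  proof -
    have "(\<Sum>l<rk1 X. ?y l * (?x i * ?W [l, j, k] - ?x j * ?W [l, i, k] + ?x k * ?W [l, i, j]))
      = ?x i * (\<Sum>l<rk1 X. ?y l * ?W [l, j, k]) - ?x j * (\<Sum>l<rk1 X. ?y l * ?W [l, i, k])
        + ?x k * (\<Sum>l<rk1 X. ?y l * ?W [l, i, j])"
      unfolding sum_distrib_left sum.distrib[symmetric] sum_subtractf[symmetric]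
      by (intro sum.cong refl) (simp only: ring_distribs, simp only: mult_ac)
    then show ?thesis
      unfolding w2_1_eq[OF w2 j k q p] w2_1_eq[OF w2 i k q p] w2_1_eq[OF w2 i j q p]
      by (simp only: ring_distribs) (simp only: mult_ac, simp)
  qed
  \<comment> \<open>The first sum vanishes by \<open>yx\<close>; it supplies the term of
    \<open>w1_1_eq\<close> for \<open>[l, i, j, k]\<close> that was still missing.\<close>
  also have "\<dots> = (\<Sum>l<rk1 X. ?y l * (?x l * ?W [i, j, k]))
      - (\<Sum>l<rk1 X. ?y l * (?x i * ?W [l, j, k] - ?x j * ?W [l, i, k] + ?x k * ?W [l, i, j]))"
    by (simp add: pluecker yx)
  also have "\<dots> = (\<Sum>l<rk1 X. ?y l * (\<Sum>t<rk3 X. ?z t * w1_1 w [l, i, j, k] s t))"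
    unfolding sum_subtractf[symmetric]
    by (intro sum.cong refl) (simp add: w1_1_eq[OF w1 _ i j k s p] algebra_simps)
  also have "\<dots> = (\<Sum>t<rk3 X. ?z t * (\<Sum>l<rk1 X. ?y l * w1_1 w [l, i, j, k] s t))"
    unfolding sum_distrib_left by (subst sum.swap) (simp add: mult_ac)
  finally show "(\<Sum>t<rk3 X. ?z t * (?x i * w2_1 w [j, k] q t - ?x j * w2_1 w [i, k] q t + ?x k * w2_1 w [i, j] q t))
    = (\<Sum>t<rk3 X. ?z t * (\<Sum>l<rk1 X. ?y l * w1_1 w [l, i, j, k] s t))" .
qed

text \<open>In the image of \<open>f s s'\<close> under \<open>diff3\<close>, the coefficient of
  \<open>w3_1\<close> on three of the five indices is, up to sign, the determinant formed by rows
  \<open>s\<close>, \<open>s'\<close> of \<open>diff1\<close> and the other two columns. It changes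
  sign when \<open>s\<close> and \<open>s'\<close> are exchanged.\<close>

lemma d1_w1_1_symmetric:
  assumes X: "exact_tail X" and w1: "is_w1_1 X w"
    and r: "a < rk1 X" "b < rk1 X" "c < rk1 X" "d < rk1 X" "e < rk1 X"
    and s: "s < 2" "s' < 2" and t: "t < rk3 X"
  defines "f \<equiv> \<lambda>s s' t. d1 X a s * w1_1 w [b, c, d, e] s' t - d1 X b s * w1_1 w [a, c, d, e] s' t
    + d1 X c s * w1_1 w [a, b, d, e] s' t - d1 X d s * w1_1 w [a, b, c, e] s' t
    + d1 X e s * w1_1 w [a, b, c, d] s' t"
  shows "f s s' t + f s' s t = 0"
proof (rule exact_tail_inj[OF X t, where u' = "\<lambda>_. 0" and u = "\<lambda>t. f s s' t + f s' s t"])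
  fix p assume p: "p < rk2 X"
  let ?z = "\<lambda>t. diff3 X $$ (p, t)"
  let ?C = "\<lambda>I s. \<Sum>t<rk3 X. ?z t * w1_1 w I s t"
  have f: "(\<Sum>t<rk3 X. ?z t * f s s' t) = d1 X a s * ?C [b, c, d, e] s' - d1 X b s * ?C [a, c, d, e] s'
    + d1 X c s * ?C [a, b, d, e] s' - d1 X d s * ?C [a, b, c, e] s' + d1 X e s * ?C [a, b, c, d] s'" for s s'
    unfolding f_def sum_distrib_left sum.distrib[symmetric] sum_subtractf[symmetric]
    by (intro sum.cong refl) (simp only: ring_distribs, simp only: mult_ac)
  have "(\<Sum>t<rk3 X. ?z t * f s s' t) + (\<Sum>t<rk3 X. ?z t * f s' s t) = 0"
    by (simp only: f w1_1_eq[OF w1 _ _ _ _ _ p] r s) (simp only: ring_distribs, simp only: mult_ac, simp)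
  then show "(\<Sum>t<rk3 X. ?z t * (f s s' t + f s' s t)) = (\<Sum>t<rk3 X. ?z t * 0)"
    by (simp add: sum.distrib distrib_left)
qed

section \<open>Signs of the lower maps under permutations of the indices\<close>

lemma w3_1_swap:
  assumes "is_w3_1 X w" "p < rk2 X" "a < rk1 X" "b < rk1 X" "c < rk1 X"
  shows "w3_1 w [b, a, c] p = - w3_1 w [a, b, c] p" "w3_1 w [a, c, b] p = - w3_1 w [a, b, c] p"
    "w3_1 w [a, a, b] p = 0" "w3_1 w [a, b, b] p = 0"
proof -
  have alt: "alternating 3 X (\<lambda>I. w3_1 w I p)" using assms unfolding is_w3_1_def by blast
  show "w3_1 w [b, a, c] p = - w3_1 w [a, b, c] p" "w3_1 w [a, c, b] p = - w3_1 w [a, b, c] p"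
    using alternating_swap[OF alt, of "[]" a b "[c]"] alternating_swap[OF alt, of "[a]" b c "[]"] assms
    by (simp_all add: index_lists_def)
  show "w3_1 w [a, a, b] p = 0" "w3_1 w [a, b, b] p = 0"
    using alternating_repeat[OF alt] assms by (simp_all add: index_lists_def)
qed

lemma w1_1_swap:
  assumes "is_w1_1 X w" "s < 2" "t < rk3 X" "a < rk1 X" "b < rk1 X" "c < rk1 X" "d < rk1 X"
  shows "w1_1 w [b, a, c, d] s t = - w1_1 w [a, b, c, d] s t"
    "w1_1 w [a, c, b, d] s t = - w1_1 w [a, b, c, d] s t"
    "w1_1 w [a, b, d, c] s t = - w1_1 w [a, b, c, d] s t"
    "w1_1 w [a, a, b, c] s t = 0" "w1_1 w [a, b, b, c] s t = 0" "w1_1 w [a, b, c, c] s t = 0"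
proof -
  have alt: "alternating 4 X (\<lambda>I. w1_1 w I s t)" using assms unfolding is_w1_1_def by blast
  show "w1_1 w [b, a, c, d] s t = - w1_1 w [a, b, c, d] s t"
    "w1_1 w [a, c, b, d] s t = - w1_1 w [a, b, c, d] s t"
    "w1_1 w [a, b, d, c] s t = - w1_1 w [a, b, c, d] s t"
    by (rule alternating_4_swap[OF alt assms(4-7)])+
  show "w1_1 w [a, a, b, c] s t = 0" "w1_1 w [a, b, b, c] s t = 0" "w1_1 w [a, b, c, c] s t = 0"
    using alternating_repeat[OF alt] assms by (simp_all add: index_lists_def)
qed

lemma w2_1_swap:
  assumes "is_w2_1 X w" "h < rk2 X" "t < rk3 X" "a < rk1 X" "b < rk1 X"
  shows "w2_1 w [b, a] h t = - w2_1 w [a, b] h t"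
proof -
  have alt: "alternating 2 X (\<lambda>I. w2_1 w I h t)" using assms unfolding is_w2_1_def by blast
  show ?thesis
    using alternating_swap[OF alt, of "[]" a b "[]"] assms
    by (simp_all add: index_lists_def)
qed

section \<open>F_1 of rank 6 and F_3 of rank 1: a row of \<open>diff2\<close> times
  \<open>w1_22\<close>\<close>

lemma sum_from_1_small:
  fixes f :: "nat \<Rightarrow> 'a::comm_monoid_add"
  shows "(\<Sum>k\<in>{1..<1}. f k) = 0"
    "(\<Sum>k\<in>{1..<2}. f k) = f 1"
    "(\<Sum>k\<in>{1..<3}. f k) = f 1 + f 2"
    "(\<Sum>k\<in>{1..<4}. f k) = f 1 + f 2 + f 3"
    "(\<Sum>k\<in>{1..<5}. f k) = f 1 + f 2 + f 3 + f 4"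
    "(\<Sum>k\<in>{1..<6}. f k) = f 1 + f 2 + f 3 + f 4 + f 5"
  by (simp_all add: eval_nat_numeral)

lemma w1_22_expand:
  assumes X: "is_w1_22 X w" and I: "[a, b, c, d, e, f] \<in> index_lists 6 X"
    and s: "s < 2" "p < rk2 X" "v < rk3 X"
  shows "kappa X (w1_22 w [a, b, c, d, e, f] a s) p v
    = w3_1 w [a, b, c] p * w1_1 w [a, d, e, f] s v - w3_1 w [a, b, d] p * w1_1 w [a, c, e, f] s v
      + w3_1 w [a, b, e] p * w1_1 w [a, c, d, f] s v - w3_1 w [a, b, f] p * w1_1 w [a, c, d, e] s v
      + w3_1 w [a, c, d] p * w1_1 w [a, b, e, f] s v - w3_1 w [a, c, e] p * w1_1 w [a, b, d, f] s v
      + w3_1 w [a, c, f] p * w1_1 w [a, b, d, e] s v + w3_1 w [a, d, e] p * w1_1 w [a, b, c, f] s v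
      - w3_1 w [a, d, f] p * w1_1 w [a, b, c, e] s v + w3_1 w [a, e, f] p * w1_1 w [a, b, c, d] s v
      + d1 X a s * w3_22 w [a, b, c, d, e, f] p v"
  using X[unfolded is_w1_22_def, THEN conjunct2, rule_format, OF I s] unfolding sum_from_1_small
  by (simp add: omit_def nths_Cons)

text \<open>The right-hand side is what the element lifted by \<open>w1_21\<close> of the linked
  complex becomes under the formulas for the lower maps; the factor on the left is an entry of the
  linked \<open>diff3\<close>. The permutation \<open>\<pi>\<close> brings any of the basis elements
  to the distinguished first place.\<close>

lemma w1_22_linkage:
  fixes X :: "'r::comm_ring_1 complex3" and \<pi> :: "nat \<Rightarrow> nat"
  assumes X: "exact_tail X" and two: "(2 :: 'r) dvd 1" and rk: "rk1 X = 6" "rk3 X = 1"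
    and w: "is_w3_1 X w" "is_w2_1 X w" "is_w1_1 X w" "is_w3_22 X w" "is_w2_22 X w" "is_w1_22 X w"
    and \<pi>: "bij_betw \<pi> {..<6} {..<6}" and s: "s < 2" and q: "q < rk2 X"
  shows "diff2 X $$ (\<pi> 5, q) * w1_22 w (map \<pi> [0, 1, 2, 3, 4, 5]) (\<pi> 0) s 0 0
    = w2_1 w [\<pi> 0, \<pi> 1] q 0 * w1_1 w [\<pi> 0, \<pi> 2, \<pi> 3, \<pi> 4] s 0
      - w2_1 w [\<pi> 0, \<pi> 2] q 0 * w1_1 w [\<pi> 0, \<pi> 1, \<pi> 3, \<pi> 4] s 0
      + w2_1 w [\<pi> 0, \<pi> 3] q 0 * w1_1 w [\<pi> 0, \<pi> 1, \<pi> 2, \<pi> 4] s 0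
      - w2_1 w [\<pi> 0, \<pi> 4] q 0 * w1_1 w [\<pi> 0, \<pi> 1, \<pi> 2, \<pi> 3] s 0
      - d1 X (\<pi> 0) s * w2_22 w (map \<pi> [0, 1, 2, 3, 4]) q 0 0" (is "?l = ?r")
proof -
  have lt: "\<pi> i < rk1 X" if "i < 6" for i using \<pi> rk that by (auto simp: bij_betw_def)
  have reindex: "(\<Sum>k<rk1 X. f k) = (\<Sum>k<6. f (\<pi> k))" for f :: "nat \<Rightarrow> 'r"
    using sum.reindex_bij_betw[OF \<pi>, of f] rk by simp
  define N where "N = w1_22 w (map \<pi> [0, 1, 2, 3, 4, 5]) (\<pi> 0) s 0 0"
  define V where "V = w2_22 w (map \<pi> [0, 1, 2, 3, 4]) q 0 0"
  define x where "x = (\<lambda>i s. d1 X (\<pi> i) s)"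
  define y where "y = (\<lambda>i. diff2 X $$ (\<pi> i, q))"
  define U where "U = (\<lambda>i j. w2_1 w [\<pi> i, \<pi> j] q 0)"
  define C where "C = (\<lambda>i j k l s. w1_1 w [\<pi> i, \<pi> j, \<pi> k, \<pi> l] s 0)"
  define m where "m = (\<lambda>i j. minor X (\<pi> i) (\<pi> j))"
  have C_zero: "C i i j k s = 0" "C i j j k s = 0" "C i j k k s = 0" if "i < 6" "j < 6" "k < 6" for i j k
    unfolding C_def using w1_1_swap(4-6)[OF w(3) s, of 0 "\<pi> i" "\<pi> j" "\<pi> k"] that lt rk by auto
  have L1: "x 0 s * U j k = x j s * U 0 k - x k s * U 0 j + (\<Sum>l<6. y l * C l 0 j k s)"
    if "j < 6" "k < 6" for j k
  proof -
    have shift: "a = b - c + r" if "a - b + c = r" for a b c r :: 'r using that by auto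
    show ?thesis
      using d1_w2_1[OF X w(2,3) lt lt lt s q, of 0 j k 0] that rk
      unfolding reindex by (intro shift) (simp add: x_def U_def C_def y_def)
  qed
  have C_sort: "i < j \<Longrightarrow> C j i k l s = - C i j k l s" "j < k \<Longrightarrow> C i k j l s = - C i j k l s"
    "k < l \<Longrightarrow> C i j l k s = - C i j k l s"  if "i < 6" "j < 6" "k < 6" "l < 6" for i j k l
    unfolding C_def using w1_1_swap(1-3)[OF w(3) s, of 0 "\<pi> i" "\<pi> j" "\<pi> k" "\<pi> l"] that lt rk by auto
  \<comment> \<open>The sum of \<open>wedge0\<close> terms in the multiple of f_h that occurs in the
    defining equation of \<open>w2_22\<close>, before halving.\<close>
  define \<Omega> where "\<Omega> = (x 0 0 * C 1 2 3 4 1 - x 0 1 * C 1 2 3 4 0) - (x 1 0 * C 0 2 3 4 1 - x 1 1 * C 0 2 3 4 0)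
      + (x 2 0 * C 0 1 3 4 1 - x 2 1 * C 0 1 3 4 0) - (x 3 0 * C 0 1 2 4 1 - x 3 1 * C 0 1 2 4 0)
      + (x 4 0 * C 0 1 2 3 1 - x 4 1 * C 0 1 2 3 0)"
  have L2: "(x 0 s * C 1 2 3 4 s' - x 1 s * C 0 2 3 4 s' + x 2 s * C 0 1 3 4 s' - x 3 s * C 0 1 2 4 s' + x 4 s * C 0 1 2 3 s')
     + (x 0 s' * C 1 2 3 4 s - x 1 s' * C 0 2 3 4 s + x 2 s' * C 0 1 3 4 s - x 3 s' * C 0 1 2 4 s + x 4 s' * C 0 1 2 3 s) = 0"
    if "s < 2" "s' < 2" for s s'
    unfolding x_def C_def by (rule d1_w1_1_symmetric[OF X w(3) lt lt lt lt lt that]) (simp_all add: rk)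
  \<comment> \<open>These minors are the multiples of f_q coming from \<open>w2_1\<close>; the
    identity matches them with those coming from \<open>w2_22\<close>. By skew-symmetry only
    \<open>S 0 1\<close> survives among the contractions, and \<open>\<Omega>\<close> is twice that
    value.\<close>
  have minors: "m 0 1 * C 0 2 3 4 s - m 0 2 * C 0 1 3 4 s + m 0 3 * C 0 1 2 4 s - m 0 4 * C 0 1 2 3 s
    = x 0 s * (half * \<Omega>)"
  proof -
    define S where "S = (\<lambda>s s'. x 0 s * C 1 2 3 4 s' - x 1 s * C 0 2 3 4 s' + x 2 s * C 0 1 3 4 s'
      - x 3 s * C 0 1 2 4 s' + x 4 s * C 0 1 2 3 s')"
    have S_sym: "S s s' = - S s' s" if "s < 2" "s' < 2" for s s'
      using L2[OF that] unfolding S_def by (rule eq_neg_iff_add_eq_0[THEN iffD2])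
    have S_diag: "S s s = 0" if "s < 2" for s
      using half_double(3)[OF two, of "S s s"] S_sym[OF that that] by simp
    have "\<Omega> = S 0 1 + - S 1 0" by (simp add: \<Omega>_def S_def)
    then have \<Omega>: "half * \<Omega> = S 0 1" using S_sym[of 1 0] half_double(3)[OF two] by simp
    have "m 0 1 * C 0 2 3 4 s - m 0 2 * C 0 1 3 4 s + m 0 3 * C 0 1 2 4 s - m 0 4 * C 0 1 2 3 s
      = x 0 1 * S 0 s - x 0 0 * S 1 s"
      unfolding S_def m_def x_def minor_def d1_def by (simp only: ring_distribs) (simp only: mult_ac, simp)
    also have "\<dots> = x 0 s * S 0 1"
      using s S_diag[of 0] S_diag[of 1] S_sym[of 1 0] by (auto simp: less_2_cases_iff)
    finally show ?thesis using \<Omega> by simp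
  qed
  \<comment> \<open>As F_3 has rank one, \<open>kappa\<close> sends the square of the generator to a
    doubled element. The lifting equations therefore give \<open>2 * z * N\<close> and
    \<open>2 * z * V\<close>, and 2 is cancelled at the end.\<close>
  have "2 * (y 5 * N + x 0 s * V - (U 0 1 * C 0 2 3 4 s - U 0 2 * C 0 1 3 4 s + U 0 3 * C 0 1 2 4 s - U 0 4 * C 0 1 2 3 s))
    = 0" (is "2 * ?E = 0")
  proof (rule exact_tail_inj[OF X, where t = 0 and u = "\<lambda>_. 2 * ?E" and u' = "\<lambda>_. 0"])
    show "0 < rk3 X" using rk by simp
    fix p assume p: "p < rk2 X"
    define z where "z = diff3 X $$ (p, 0)"
    define \<delta> :: 'r where "\<delta> = of_bool (p = q)"
    define W where "W = (\<lambda>i j k. w3_1 w [\<pi> i, \<pi> j, \<pi> k] p)"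
    define F where "F = w3_22 w (map \<pi> [0, 1, 2, 3, 4, 5]) p 0"
    have W_zero: "W i i j = 0" "W i j j = 0" if "i < 6" "j < 6" for i j
      unfolding W_def using w3_1_swap(3,4)[OF w(1) p, of "\<pi> i" "\<pi> j"] that lt by auto
    have R2: "z * U i j = m i j * \<delta> - (\<Sum>k<6. y k * W k i j)" if "i < 6" "j < 6" for i j
      using w2_1_eq[OF w(2), of "\<pi> i" "\<pi> j" q p] lt that q p rk(2)
      unfolding reindex by (simp add: z_def U_def m_def \<delta>_def y_def W_def)
    have R3: "z * C i j k l s = x i s * W j k l - x j s * W i k l + x k s * W i j l - x l s * W i j k"
      if "i < 6" "j < 6" "k < 6" "l < 6" for i j k l
      using w1_1_eq[OF w(3) lt lt lt lt, of i j k l s p] that s p rk(2)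
      by (simp add: z_def C_def x_def W_def)
    have W_sort: "i < j \<Longrightarrow> W j i k = - W i j k" "j < k \<Longrightarrow> W i k j = - W i j k"
      if "i < 6" "j < 6" "k < 6" for i j k
      unfolding W_def using w3_1_swap(1,2)[OF w(1) p, of "\<pi> i" "\<pi> j" "\<pi> k"] that lt by auto
    have I5: "map \<pi> [0, 1, 2, 3, 4] \<in> index_lists 5 X" and I6: "map \<pi> [0, 1, 2, 3, 4, 5] \<in> index_lists 6 X"
      using lt by (simp_all add: index_lists_def)
    have RV: "2 * z * V = U 0 1 * W 2 3 4 - U 0 2 * W 1 3 4 + U 0 3 * W 1 2 4 - U 0 4 * W 1 2 3
       + U 1 2 * W 0 3 4 - U 1 3 * W 0 2 4 + U 1 4 * W 0 2 3 + U 2 3 * W 0 1 4 - U 2 4 * W 0 1 3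
       + U 3 4 * W 0 1 2 + half * \<delta> * \<Omega> - y 5 * F"
    proof -
      \<comment> \<open>Of the contraction of \<open>w3_22\<close> with \<open>diff2\<close> only
        the sixth index remains: each of the others is already in the list.\<close>
      have F0: "w3_22 w (map \<pi> [0, 1, 2, 3, 4] @ [\<pi> k]) p 0 = (if k = 5 then F else 0)" if "k < 6" for k
      proof (cases "k = 5")
        case False
        have "alternating 6 X (\<lambda>I. w3_22 w I p 0)" using w(4) p rk(2) unfolding is_w3_22_def by simp
        moreover have "map \<pi> [0, 1, 2, 3, 4] @ [\<pi> k] \<in> index_lists 6 X"
          using lt that by (simp add: index_lists_def)
        moreover have "k \<in> {0, 1, 2, 3, 4}" using False that by auto
        then have "\<not> distinct (map \<pi> [0, 1, 2, 3, 4] @ [\<pi> k])" by auto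
        ultimately show ?thesis using alternating_repeat False by fastforce
      qed (simp add: F_def)
      have "2 * z * V = kappa X (w2_22 w (map \<pi> [0, 1, 2, 3, 4]) q) p 0"
        using rk by (simp add: kappa_def z_def V_def mult_ac)
      also note w(5)[unfolded is_w2_22_def, THEN conjunct2, rule_format, OF I5 q p, of 0]
      finally show ?thesis
        unfolding reindex unfolding sum_lessThan_small
        by (simp add: rk F0[simplified] omit_def nths_Cons wedge0_r_def wedge0_def \<Omega>_def
            W_def U_def C_def x_def y_def \<delta>_def[symmetric])
          (simp only: ring_expand, simp only: mult_ac, simp)
    qed
    have RN: "2 * z * N = W 0 1 2 * C 0 3 4 5 s - W 0 1 3 * C 0 2 4 5 s + W 0 1 4 * C 0 2 3 5 s - W 0 1 5 * C 0 2 3 4 s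
      + W 0 2 3 * C 0 1 4 5 s - W 0 2 4 * C 0 1 3 5 s + W 0 2 5 * C 0 1 3 4 s + W 0 3 4 * C 0 1 2 5 s
      - W 0 3 5 * C 0 1 2 4 s + W 0 4 5 * C 0 1 2 3 s + x 0 s * F"
    proof -
      have "0 < rk3 X" using rk by simp
      note E = w1_22_expand[OF w(6) I6[unfolded list.map] s p this]
      have "2 * z * N = kappa X (w1_22 w [\<pi> 0, \<pi> 1, \<pi> 2, \<pi> 3, \<pi> 4, \<pi> 5] (\<pi> 0) s) p 0"
        using rk by (simp add: kappa_def z_def N_def mult_ac)
      then show ?thesis unfolding E F_def W_def C_def x_def list.map .
    qed
    show "(\<Sum>t<rk3 X. diff3 X $$ (p, t) * (2 * ?E)) = (\<Sum>t<rk3 X. diff3 X $$ (p, t) * 0)"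
    proof -
      \<comment> \<open>\<open>?Y\<close> is the remainder in \<open>L1\<close> and
        \<open>?S\<close> is the contraction in \<open>R2\<close>. Vanishing on repeated indices
        leaves three terms of each \<open>?Y\<close> and four of each \<open>?S\<close>.\<close>
      let ?Y = "\<lambda>j k. \<Sum>l<6. y l * C l 0 j k s" and ?S = "\<lambda>l. \<Sum>k<6. y k * W k 0 l"
      have Y: "?Y 1 2 = - (y 3 * C 0 1 2 3 s) - y 4 * C 0 1 2 4 s - y 5 * C 0 1 2 5 s"
        "?Y 1 3 = y 2 * C 0 1 2 3 s - y 4 * C 0 1 3 4 s - y 5 * C 0 1 3 5 s"
        "?Y 1 4 = y 2 * C 0 1 2 4 s + y 3 * C 0 1 3 4 s - y 5 * C 0 1 4 5 s"
        "?Y 2 3 = - (y 1 * C 0 1 2 3 s) - y 4 * C 0 2 3 4 s - y 5 * C 0 2 3 5 s"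
        "?Y 2 4 = - (y 1 * C 0 1 2 4 s) + y 3 * C 0 2 3 4 s - y 5 * C 0 2 4 5 s"
        "?Y 3 4 = - (y 1 * C 0 1 3 4 s) - y 2 * C 0 2 3 4 s - y 5 * C 0 3 4 5 s"
        unfolding sum_lessThan_small by (simp_all add: C_sort C_zero)
      have S: "?S 1 = y 2 * W 0 1 2 + y 3 * W 0 1 3 + y 4 * W 0 1 4 + y 5 * W 0 1 5"
        "?S 2 = - (y 1 * W 0 1 2) + y 3 * W 0 2 3 + y 4 * W 0 2 4 + y 5 * W 0 2 5"
        "?S 3 = - (y 1 * W 0 1 3) - y 2 * W 0 2 3 + y 4 * W 0 3 4 + y 5 * W 0 3 5"
        "?S 4 = - (y 1 * W 0 1 4) - y 2 * W 0 2 4 - y 3 * W 0 3 4 + y 5 * W 0 4 5"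
        unfolding sum_lessThan_small by (simp_all add: W_sort W_zero)
      define B where "B = U 0 1 * C 0 2 3 4 s - U 0 2 * C 0 1 3 4 s + U 0 3 * C 0 1 2 4 s - U 0 4 * C 0 1 2 3 s"
      have "z * B = (z * U 0 1) * C 0 2 3 4 s - (z * U 0 2) * C 0 1 3 4 s + (z * U 0 3) * C 0 1 2 4 s
          - (z * U 0 4) * C 0 1 2 3 s"
        unfolding B_def by (simp only: ring_expand, simp only: mult_ac)
      also have "\<dots> = (m 0 1 * \<delta> - ?S 1) * C 0 2 3 4 s - (m 0 2 * \<delta> - ?S 2) * C 0 1 3 4 s
          + (m 0 3 * \<delta> - ?S 3) * C 0 1 2 4 s - (m 0 4 * \<delta> - ?S 4) * C 0 1 2 3 s"
        by (simp add: R2)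
      also have "\<dots> = (m 0 1 * C 0 2 3 4 s - m 0 2 * C 0 1 3 4 s + m 0 3 * C 0 1 2 4 s - m 0 4 * C 0 1 2 3 s) * \<delta>
          - (?S 1 * C 0 2 3 4 s - ?S 2 * C 0 1 3 4 s + ?S 3 * C 0 1 2 4 s - ?S 4 * C 0 1 2 3 s)"
        by (simp only: ring_expand, simp only: mult_ac, simp)
      finally have zB_eq: "z * B = x 0 s * (half * \<Omega>) * \<delta>
          - (?S 1 * C 0 2 3 4 s - ?S 2 * C 0 1 3 4 s + ?S 3 * C 0 1 2 4 s - ?S 4 * C 0 1 2 3 s)"
        unfolding minors .
      \<comment> \<open>A second evaluation of \<open>z * B\<close>: here \<open>z\<close> is
        attached to the factors \<open>C\<close>, for use with \<open>R3\<close>, whereas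
        \<open>zB_eq\<close> attached it to the factors \<open>U\<close>, using \<open>R2\<close>.
        One of the two copies of \<open>z * B\<close> is removed in each way.\<close>
      have zB': "z * B = U 0 1 * (z * C 0 2 3 4 s) - U 0 2 * (z * C 0 1 3 4 s) + U 0 3 * (z * C 0 1 2 4 s)
          - U 0 4 * (z * C 0 1 2 3 s)"
        unfolding B_def by (simp only: ring_expand, simp only: mult_ac)
      txt \<open>The relation L1 trades the products of x 0 s and U j k with j, k > 0 for multiples of U 0 j and U 0 k.
        Together the multiples of U 0 l then have coefficients as in R3, which is how z * B arises.\<close>
      have "x 0 s * (2 * z * V) = x 0 s * (U 0 1 * W 2 3 4 - U 0 2 * W 1 3 4 + U 0 3 * W 1 2 4 - U 0 4 * W 1 2 3)
          + (x 0 s * U 1 2) * W 0 3 4 - (x 0 s * U 1 3) * W 0 2 4 + (x 0 s * U 1 4) * W 0 2 3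
          + (x 0 s * U 2 3) * W 0 1 4 - (x 0 s * U 2 4) * W 0 1 3 + (x 0 s * U 3 4) * W 0 1 2
          + x 0 s * (half * \<Omega>) * \<delta> - x 0 s * y 5 * F"
        unfolding RV by (simp only: ring_expand, simp only: mult_ac)
      also have "\<dots> = z * B + (?Y 1 2 * W 0 3 4 - ?Y 1 3 * W 0 2 4 + ?Y 1 4 * W 0 2 3
          + ?Y 2 3 * W 0 1 4 - ?Y 2 4 * W 0 1 3 + ?Y 3 4 * W 0 1 2)
          + x 0 s * (half * \<Omega>) * \<delta> - x 0 s * y 5 * F"
        unfolding zB' by (simp only: L1 R3 numeral_less_iff rel_simps one_less_numeral_iff zero_less_numeral)
          (simp only: ring_expand, simp only: mult_ac, simp)
      finally have xV: "x 0 s * (2 * z * V) = \<dots>" .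
      have "z * (2 * ?E) = y 5 * (2 * z * N) + x 0 s * (2 * z * V) - 2 * (z * B)"
        unfolding B_def[symmetric] by (simp only: ring_expand, simp only: mult_ac)
      also have "\<dots> = y 5 * (2 * z * N) + (?Y 1 2 * W 0 3 4 - ?Y 1 3 * W 0 2 4 + ?Y 1 4 * W 0 2 3
          + ?Y 2 3 * W 0 1 4 - ?Y 2 4 * W 0 1 3 + ?Y 3 4 * W 0 1 2)
          + (?S 1 * C 0 2 3 4 s - ?S 2 * C 0 1 3 4 s + ?S 3 * C 0 1 2 4 s - ?S 4 * C 0 1 2 3 s)
          - x 0 s * y 5 * F"
        unfolding xV zB_eq by simp
      \<comment> \<open>The multiples of \<open>\<delta>\<close> are gone already. Inserting
        \<open>RN\<close> cancels the terms with \<open>F\<close>, and then the coefficient of each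
        \<open>y\<close> vanishes separately.\<close>
      also have "\<dots> = 0"
        unfolding RN Y S by (simp only: ring_expand, simp only: mult_ac, simp)
      finally show ?thesis using rk by (simp add: z_def)
    qed
  qed
  moreover have "u = 0" if "2 * u = 0" for u :: 'r
    using half_double(1)[OF two, of u] that by simp
  ultimately have "?E = 0" by blast
  then show ?thesis
    unfolding N_def V_def x_def y_def U_def C_def by (simp add: algebra_simps)
qed

section \<open>F_1 of rank 5 and F_3 of rank 2: a row of \<open>diff2\<close> times
  \<open>w1_3\<close>\<close>

lemma w2_21_expand:
  assumes X: "is_w2_21 X w" and w3: "is_w3_21 X w" and rk: "rk1 X = 5" "rk3 X = 2"
    and I: "distinct [a, b, c, d, e]" "{a, b, c, d, e} \<subseteq> {..<5}"
    and h: "h < rk2 X" "p < rk2 X" "v < 2"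
  shows "iota X (w2_21 w [a, b, c, d] a h) p v
    = w3_1 w [a, b, c] p * w2_1 w [a, d] h v - w3_1 w [a, b, d] p * w2_1 w [a, c] h v
      + w3_1 w [a, c, d] p * w2_1 w [a, b] h v
      + of_bool (p = h) * (d1 X a 0 * w1_1 w [a, b, c, d] 1 v - d1 X a 1 * w1_1 w [a, b, c, d] 0 v)
      - diff2 X $$ (e, h) * w3_21 w [a, b, c, d, e] a p v"
proof -
  have lt: "a < 5" "b < 5" "c < 5" "d < 5" "e < 5" using I(2) by auto
  \<comment> \<open>In rank 5 the one index outside \<open>[a, b, c, d]\<close> is \<open>e\<close>,
    so the contraction of \<open>w3_21\<close> with \<open>diff2\<close> reduces to a single
    term.\<close>
  have zero: "w3_21 w [a, b, c, d, k] a p v = 0" if "k \<in> {a, b, c, d}" for k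
  proof -
    have "alternating 5 X (\<lambda>I. w3_21 w I a p v)" using w3 lt h rk unfolding is_w3_21_def by simp
    moreover have "[a, b, c, d, k] \<in> index_lists 5 X" "\<not> distinct [a, b, c, d, k]"
      using that lt rk by (auto simp: index_lists_def)
    ultimately show ?thesis by (rule alternating_repeat)
  qed
  have "(\<Sum>k<rk1 X. diff2 X $$ (k, h) * w3_21 w [a, b, c, d, k] a p v)
    = (\<Sum>k\<in>{a, b, c, d, e}. diff2 X $$ (k, h) * w3_21 w [a, b, c, d, k] a p v)"
  proof -
    have "{a, b, c, d, e} = {..<5}" using I by (intro card_subset_eq) auto
    then show ?thesis using rk by simp
  qed
  also have "\<dots> = diff2 X $$ (e, h) * w3_21 w [a, b, c, d, e] a p v"
    using I(1) by (simp add: zero)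
  finally have sum: "(\<Sum>k<rk1 X. diff2 X $$ (k, h) * w3_21 w [a, b, c, d, k] a p v)
    = diff2 X $$ (e, h) * w3_21 w [a, b, c, d, e] a p v" .
  have "[a, b, c, d] \<in> index_lists 4 X" using lt rk by (simp add: index_lists_def)
  from X[unfolded is_w2_21_def, THEN conjunct2, THEN conjunct1, rule_format, OF this h(1,2), of v]
  show ?thesis using h rk by (simp add: wedge0_def sum[unfolded rk(1)])
qed

lemma w1_21_expand:
  assumes X: "is_w1_21 X w" and rk: "rk1 X = 5" "rk3 X = 2"
    and I: "a < 5" "b < 5" "c < 5" "d < 5" "e < 5" and s: "s < 2" "p < rk2 X" "v < 2"
  shows "iota X (w1_21 w [a, b, c, d, e] [a, b] s) p v
    = w3_1 w [a, b, c] p * w1_1 w [a, b, d, e] s v - w3_1 w [a, b, d] p * w1_1 w [a, b, c, e] s v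
      + w3_1 w [a, b, e] p * w1_1 w [a, b, c, d] s v
      + d1 X a s * w3_21 w [a, b, c, d, e] b p v - d1 X b s * w3_21 w [a, b, c, d, e] a p v"
proof -
  have "[a, b, c, d, e] \<in> index_lists 5 X" using I rk by (simp add: index_lists_def)
  from X[unfolded is_w1_21_def, THEN conjunct2, THEN conjunct2, rule_format, OF this s(1,2), of v]
  have E: "iota X (w1_21 w [a, b, c, d, e] [[a, b, c, d, e] ! 0, [a, b, c, d, e] ! 1] s) p v
    = (\<Sum>i\<in>{2..<5}. (- 1) ^ i * w3_1 w [[a, b, c, d, e] ! 0, [a, b, c, d, e] ! 1, [a, b, c, d, e] ! i] p
         * w1_1 w (omit [a, b, c, d, e] {i}) s v)
      + (\<Sum>j<2. (- 1) ^ j * d1 X ([a, b, c, d, e] ! j) s * w3_21 w [a, b, c, d, e] ([a, b, c, d, e] ! (1 - j)) p v)"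
    using s rk by simp
  have "{2..<5::nat} = {2, 3, 4}" by auto
  with E show ?thesis by (simp add: sum_lessThan_small omit_def nths_Cons)
qed

text \<open>The second exterior power of F_3 has the single generator g_0 \<and> g_1 here, and the
  coordinate of its image at g_v involves the complementary column \<open>1 - v\<close> of
  \<open>diff3\<close>.\<close>

lemma iota_rank2:
  assumes "rk3 X = 2" "v < 2"
  shows "iota X c p v = c 0 1 * (if v = 0 then - diff3 X $$ (p, 1) else diff3 X $$ (p, 0))"
  using assms by (auto simp: iota_def sum_lessThan_small less_2_cases_iff)


text \<open>The right-hand side is, up to a sign depending on \<open>t\<close>, the element lifted
  by \<open>w1_22\<close> of the linked complex. The 2 on the left anticipates \<open>kappa\<close>
  there, as D_3 has rank one.\<close>

lemma w1_3_linkage: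
  fixes X :: "'r::comm_ring_1 complex3"
  assumes X: "exact_tail X" and two: "(2 :: 'r) dvd 1" and rk: "rk1 X = 5" "rk3 X = 2"
    and w: "is_w3_1 X w" "is_w2_1 X w" "is_w1_1 X w" "is_w3_21 X w" "is_w2_21 X w" "is_w1_21 X w" "is_w1_3 X w"
    and s: "s < 2" and q: "q < rk2 X" and t: "t < 2"
  defines "U \<equiv> \<lambda>i j. w2_1 w [i, j] q t" and "K \<equiv> \<lambda>i. w2_21 w [0, 1, 2, 3] i q 0 1"
    and "B \<equiv> \<lambda>i j. w1_21 w [0, 1, 2, 3, 4] [i, j] s 0 1"
    and "C \<equiv> \<lambda>i j k l s. w1_1 w [i, j, k, l] s t"
  shows "2 * (diff2 X $$ (4, q) * w1_3 w [0, 1, 2, 3, 4] [0, 1, 2, 3, 4] s 0 1 t)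
    = - (K 0 * C 1 2 3 4 s - K 1 * C 0 2 3 4 s + K 2 * C 0 1 3 4 s - K 3 * C 0 1 2 4 s + K 4 * C 0 1 2 3 s)
      + (U 2 3 * B 0 1 - U 1 3 * B 0 2 + U 1 2 * B 0 3 + U 0 3 * B 1 2 - U 0 2 * B 1 3 + U 0 1 * B 2 3)"
    (is "2 * (_ * ?N) = ?r")
proof -
  define x where "x = (\<lambda>i s. d1 X i s)"
  define y where "y = (\<lambda>i. diff2 X $$ (i, q))"
  have C_sort: "i < j \<Longrightarrow> C j i k l s' = - C i j k l s'" "j < k \<Longrightarrow> C i k j l s' = - C i j k l s'"
    "k < l \<Longrightarrow> C i j l k s' = - C i j k l s'"  if "i < 5" "j < 5" "k < 5" "l < 5" "s' < 2" for i j k l s'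
    unfolding C_def using w1_1_swap(1-3)[OF w(3) that(5), of t i j k l] that t rk by auto
  have C_zero: "C i i j k s = 0" "C i j j k s = 0" "C i j k k s = 0" if "i < 5" "j < 5" "k < 5" for i j k
    unfolding C_def using w1_1_swap(4-6)[OF w(3) s, of t i j k] that t rk by auto
  have L1: "x i s * U j k - x j s * U i k + x k s * U i j = (\<Sum>l<5. y l * C l i j k s)"
    if "i < 5" "j < 5" "k < 5" for i j k
    using d1_w2_1[OF X w(2,3) _ _ _ s q, of i j k t] that t rk by (simp add: x_def U_def C_def y_def)
  define S where "S = (\<lambda>s s'. x 0 s * C 1 2 3 4 s' - x 1 s * C 0 2 3 4 s' + x 2 s * C 0 1 3 4 s'
      - x 3 s * C 0 1 2 4 s' + x 4 s * C 0 1 2 3 s')"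
  have S_sym: "S s s' = - S s' s" if "s < 2" "s' < 2" for s s'
    unfolding S_def x_def C_def eq_neg_iff_add_eq_0
    by (rule d1_w1_1_symmetric[OF X w(3) _ _ _ _ _ that]) (simp_all add: rk t)
  have S_diag: "S s s = 0" if "s < 2" for s
    using half_double(3)[OF two, of "S s s"] S_sym[OF that that] by simp
  define \<Omega> where "\<Omega> = (x 0 0 * C 1 2 3 4 1 - x 0 1 * C 1 2 3 4 0) - (x 1 0 * C 0 2 3 4 1 - x 1 1 * C 0 2 3 4 0)
      + (x 2 0 * C 0 1 3 4 1 - x 2 1 * C 0 1 3 4 0) - (x 3 0 * C 0 1 2 4 1 - x 3 1 * C 0 1 2 4 0)
      + (x 4 0 * C 0 1 2 3 1 - x 4 1 * C 0 1 2 3 0)"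
  have "\<Omega> = S 0 1 + - S 1 0" by (simp add: \<Omega>_def S_def)
  then have \<Omega>: "half * \<Omega> = S 0 1" using S_sym[of 1 0] half_double(3)[OF two] by simp
  define P where "P = (\<lambda>i. x i 0 * C 0 1 2 3 1 - x i 1 * C 0 1 2 3 0)"
  txt \<open>This Pluecker-type relation makes the multiples of f_q cancel.\<close>
  have P: "P 0 * C 1 2 3 4 s - P 1 * C 0 2 3 4 s + P 2 * C 0 1 3 4 s - P 3 * C 0 1 2 4 s + P 4 * C 0 1 2 3 s
    = half * \<Omega> * C 0 1 2 3 s"
  proof -
    have "P 0 * C 1 2 3 4 s - P 1 * C 0 2 3 4 s + P 2 * C 0 1 3 4 s - P 3 * C 0 1 2 4 s + P 4 * C 0 1 2 3 s
      = S 0 s * C 0 1 2 3 1 - S 1 s * C 0 1 2 3 0"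
      unfolding P_def S_def by (simp only: ring_expand, simp only: mult_ac, simp)
    then show ?thesis
      using s S_diag[of 0] S_diag[of 1] S_sym[of 1 0] \<Omega> by (auto simp: less_2_cases_iff)
  qed
  let ?d = "2 * (y 4 * ?N) - ?r"
  \<comment> \<open>The factor by which \<open>iota\<close> multiplies in coordinate
    \<open>t\<close>. It takes the place of \<open>z\<close>: all lifting equations along
    \<open>iota\<close> are read off in this one coordinate.\<close>
  define \<zeta> where "\<zeta> = (\<lambda>p. if t = 0 then - diff3 X $$ (p, 1) else diff3 X $$ (p, 0))"
  have d\<zeta>: "?d * \<zeta> p = 0" if p: "p < rk2 X" for p
  proof -
    define \<delta> :: 'r where "\<delta> = of_bool (p = q)"
    define W where "W = (\<lambda>i j k. w3_1 w [i, j, k] p)"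
    define T where "T = (\<lambda>i. w3_21 w [0, 1, 2, 3, 4] i p t)"
    have W_sort: "i < j \<Longrightarrow> W j i k = - W i j k" "j < k \<Longrightarrow> W i k j = - W i j k"
      if "i < 5" "j < 5" "k < 5" for i j k
      unfolding W_def using w3_1_swap(1,2)[OF w(1) p, of i j k] that rk by auto
    have U_sort: "U j i = - U i j" if "i < j" "i < 5" "j < 5" for i j
      unfolding U_def using w2_1_swap[OF w(2) q, of t i j] that t rk by simp
    have T_sort: "i < j \<Longrightarrow> w3_21 w [j, i, k, l, 4] a p t = - w3_21 w [i, j, k, l, 4] a p t"
      "j < k \<Longrightarrow> w3_21 w [i, k, j, l, 4] a p t = - w3_21 w [i, j, k, l, 4] a p t"
      "k < l \<Longrightarrow> w3_21 w [i, j, l, k, 4] a p t = - w3_21 w [i, j, k, l, 4] a p t"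
      if "i < 5" "j < 5" "k < 5" "l < 5" "a < 5" for i j k l a
    proof -
      have "alternating 5 X (\<lambda>I. w3_21 w I a p t)" using w(4) rk t p that unfolding is_w3_21_def by simp
      from alternating_5_swap(1-3)[OF this, of i j k l 4] show "i < j \<Longrightarrow> w3_21 w [j, i, k, l, 4] a p t = - w3_21 w [i, j, k, l, 4] a p t"
      "j < k \<Longrightarrow> w3_21 w [i, k, j, l, 4] a p t = - w3_21 w [i, j, k, l, 4] a p t"
      "k < l \<Longrightarrow> w3_21 w [i, j, l, k, 4] a p t = - w3_21 w [i, j, k, l, 4] a p t" using that rk by auto
    qed
    have K_sort: "i < j \<Longrightarrow> w2_21 w [j, i, k, l] a q 0 1 = - w2_21 w [i, j, k, l] a q 0 1"
      "j < k \<Longrightarrow> w2_21 w [i, k, j, l] a q 0 1 = - w2_21 w [i, j, k, l] a q 0 1"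
      "k < l \<Longrightarrow> w2_21 w [i, j, l, k] a q 0 1 = - w2_21 w [i, j, k, l] a q 0 1"
      if "i < 5" "j < 5" "k < 5" "l < 5" "a < 5" for i j k l a
    proof -
      have "alternating 4 X (\<lambda>I. w2_21 w I a q 0 1)" using w(5) rk q that unfolding is_w2_21_def by simp
      from alternating_4_swap[OF this, of i j k l] show "i < j \<Longrightarrow> w2_21 w [j, i, k, l] a q 0 1 = - w2_21 w [i, j, k, l] a q 0 1"
      "j < k \<Longrightarrow> w2_21 w [i, k, j, l] a q 0 1 = - w2_21 w [i, j, k, l] a q 0 1"
      "k < l \<Longrightarrow> w2_21 w [i, j, l, k] a q 0 1 = - w2_21 w [i, j, k, l] a q 0 1" using that rk by auto
    qed
    have B_sort: "i < j \<Longrightarrow> w1_21 w [j, i, k, l, 4] J s 0 1 = - w1_21 w [i, j, k, l, 4] J s 0 1"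
      "j < k \<Longrightarrow> w1_21 w [i, k, j, l, 4] J s 0 1 = - w1_21 w [i, j, k, l, 4] J s 0 1"
      "k < l \<Longrightarrow> w1_21 w [i, j, l, k, 4] J s 0 1 = - w1_21 w [i, j, k, l, 4] J s 0 1"
      if "i < 5" "j < 5" "k < 5" "l < 5" "length J = 2" "set J \<subseteq> {..<5}" for i j k l J
    proof -
      have "alternating 5 X (\<lambda>I. w1_21 w I J s 0 1)" using w(6) rk s that unfolding is_w1_21_def
        by (auto simp: index_lists_def)
      from alternating_5_swap(1-3)[OF this, of i j k l 4] show "i < j \<Longrightarrow> w1_21 w [j, i, k, l, 4] J s 0 1 = - w1_21 w [i, j, k, l, 4] J s 0 1"
      "j < k \<Longrightarrow> w1_21 w [i, k, j, l, 4] J s 0 1 = - w1_21 w [i, j, k, l, 4] J s 0 1"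
      "k < l \<Longrightarrow> w1_21 w [i, j, l, k, 4] J s 0 1 = - w1_21 w [i, j, k, l, 4] J s 0 1" using that rk by auto
    qed
    have iota: "iota X c p t = c 0 1 * \<zeta> p" for c
      using iota_rank2[OF rk(2) t] by (simp add: \<zeta>_def)
    have K_eq: "w2_21 w [a, b, c, d] a q 0 1 * \<zeta> p = W a b c * U a d - W a b d * U a c + W a c d * U a b
        + \<delta> * (x a 0 * C a b c d 1 - x a 1 * C a b c d 0) - y e * w3_21 w [a, b, c, d, e] a p t"
      if "distinct [a, b, c, d, e]" "{a, b, c, d, e} \<subseteq> {..<5}" for a b c d e
      using w2_21_expand[OF w(5,4) rk that q p t]
      unfolding iota W_def U_def x_def y_def C_def \<delta>_def .
    \<comment> \<open>For the indices 0 to 3 the first formula for \<open>w2_21\<close> applies once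
      the distinguished index is moved to the front. The equations carry the alternating signs of
      the contraction in \<open>?r\<close>.\<close>
    have K0: "K 0 * \<zeta> p = W 0 1 2 * U 0 3 - W 0 1 3 * U 0 2 + W 0 2 3 * U 0 1 + \<delta> * P 0 - y 4 * T 0"
      using K_eq[of 0 1 2 3 4] by (simp add: K_def P_def T_def)
    have K1: "- (K 1 * \<zeta> p) = - (W 0 1 2 * U 1 3) + W 0 1 3 * U 1 2 - W 1 2 3 * U 0 1 - \<delta> * P 1 + y 4 * T 1"
      using K_eq[of 1 0 2 3 4] by (simp add: K_def P_def T_def K_sort[unfolded One_nat_def] W_sort U_sort C_sort T_sort right_diff_distrib)
    have K2: "K 2 * \<zeta> p = W 0 1 2 * U 2 3 - W 0 2 3 * U 1 2 + W 1 2 3 * U 0 2 + \<delta> * P 2 - y 4 * T 2"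
      using K_eq[of 2 0 1 3 4] by (simp add: K_def P_def T_def K_sort[unfolded One_nat_def] W_sort U_sort C_sort T_sort right_diff_distrib)
    have K3: "- (K 3 * \<zeta> p) = - (W 0 1 3 * U 2 3) + W 0 2 3 * U 1 3 - W 1 2 3 * U 0 3 - \<delta> * P 3 + y 4 * T 3"
      using K_eq[of 3 0 1 2 4] by (simp add: K_def P_def T_def K_sort[unfolded One_nat_def] W_sort U_sort C_sort T_sort right_diff_distrib)
    \<comment> \<open>The index 4 lies outside \<epsilon>, so the second formula applies. It is the
      source of \<open>half * \<Omega>\<close>, and \<open>T 4\<close> appears twice because both of
      its \<open>w3_21\<close> terms contribute.\<close>
    have K4: "K 4 * \<zeta> p = U 2 3 * W 0 1 4 - U 1 3 * W 0 2 4 + U 0 3 * W 1 2 4 + U 1 2 * W 0 3 4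
        - U 0 2 * W 1 3 4 + U 0 1 * W 2 3 4 + \<delta> * (P 4 - half * \<Omega>)
        - (y 0 * T 0 + y 1 * T 1 + y 2 * T 2 + y 3 * T 3 + 2 * (y 4 * T 4))"
    proof -
      have I: "[0, 1, 2, 3, 4] \<in> index_lists 5 X" "distinct [0, 1, 2, 3, 4 :: nat]"
        using rk by (simp_all add: index_lists_def)
      have t': "t < rk3 X" using rk t by simp
      have T0: "w3_21 w [0, 1, 2, 3, k] 4 p t = 0" if "k < 4" for k
      proof -
        have "alternating 5 X (\<lambda>I. w3_21 w I 4 p t)" using w(4) rk t p unfolding is_w3_21_def by simp
        moreover have "[0, 1, 2, 3, k] \<in> index_lists 5 X" using that rk by (simp add: index_lists_def)
        moreover have "\<not> distinct [0, 1, 2, 3, k]" using that by auto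
        ultimately show ?thesis using alternating_repeat by fast
      qed
      note E = w(5)[unfolded is_w2_21_def, THEN conjunct2, THEN conjunct2, THEN mp, OF rk(1), rule_format,
          OF I q p t', unfolded rk(1) sum_lessThan_small]
      have "K 4 * \<zeta> p = iota X (w2_21 w (take 4 [0, 1, 2, 3, 4]) ([0, 1, 2, 3, 4] ! 4) q) p t"
        by (simp add: iota K_def)
      also note E
      finally show ?thesis
        by (simp add: omit_def nths_Cons wedge0_r_def wedge0_def T0[unfolded One_nat_def] T_def W_def U_def C_def
            x_def y_def \<delta>_def[symmetric] P_def \<Omega>_def)
          (simp only: ring_expand, simp only: mult_ac, simp add: half_double(2)[OF two])
    qed
    have B_eq: "w1_21 w [a, b, c, d, 4] [a, b] s 0 1 * \<zeta> p
        = W a b c * C a b d 4 s - W a b d * C a b c 4 s + W a b 4 * C a b c d s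
          + x a s * w3_21 w [a, b, c, d, 4] b p t - x b s * w3_21 w [a, b, c, d, 4] a p t"
      if "a < 5" "b < 5" "c < 5" "d < 5" for a b c d
      using w1_21_expand[OF w(6) rk that _ s p t, of 4] unfolding iota W_def x_def C_def by simp
    have B01: "B 0 1 * \<zeta> p = W 0 1 2 * C 0 1 3 4 s - W 0 1 3 * C 0 1 2 4 s + W 0 1 4 * C 0 1 2 3 s
        + x 0 s * T 1 - x 1 s * T 0"
      using B_eq[of 0 1 2 3] by (simp add: B_def T_def)
    have B_perm: "w1_21 w [0, 2, 1, 3, 4] [0, 2] s 0 1 = - B 0 2" "w1_21 w [0, 3, 1, 2, 4] [0, 3] s 0 1 = B 0 3"
      "w1_21 w [1, 2, 0, 3, 4] [1, 2] s 0 1 = B 1 2" "w1_21 w [1, 3, 0, 2, 4] [1, 3] s 0 1 = - B 1 3"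
      "w1_21 w [2, 3, 0, 1, 4] [2, 3] s 0 1 = B 2 3"
      unfolding B_def by (simp_all add: B_sort[unfolded One_nat_def])
    have T_perm: "w3_21 w [0, 2, 1, 3, 4] a p t = - T a" "w3_21 w [0, 3, 1, 2, 4] a p t = T a"
      "w3_21 w [1, 2, 0, 3, 4] a p t = T a" "w3_21 w [1, 3, 0, 2, 4] a p t = - T a"
      "w3_21 w [2, 3, 0, 1, 4] a p t = T a" if "a < 5" for a
      unfolding T_def by (simp_all add: T_sort that)
    have W_perm: "W 0 2 1 = - W 0 1 2" "W 0 3 1 = - W 0 1 3" "W 0 3 2 = - W 0 2 3" "W 1 2 0 = W 0 1 2"
      "W 1 3 0 = W 0 1 3" "W 1 3 2 = - W 1 2 3" "W 2 3 0 = W 0 2 3" "W 2 3 1 = W 1 2 3"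
      by (simp_all add: W_sort)
    have C_perm: "C 0 2 1 4 s = - C 0 1 2 4 s" "C 0 2 1 3 s = - C 0 1 2 3 s" "C 0 3 2 4 s = - C 0 2 3 4 s"
      "C 0 3 1 4 s = - C 0 1 3 4 s" "C 0 3 1 2 s = C 0 1 2 3 s" "C 1 2 0 4 s = C 0 1 2 4 s"
      "C 1 2 0 3 s = C 0 1 2 3 s" "C 1 3 2 4 s = - C 1 2 3 4 s" "C 1 3 0 4 s = C 0 1 3 4 s"
      "C 1 3 0 2 s = - C 0 1 2 3 s" "C 2 3 1 4 s = C 1 2 3 4 s" "C 2 3 0 4 s = C 0 2 3 4 s"
      "C 2 3 0 1 s = C 0 1 2 3 s"
      using s by (simp_all add: C_sort)
    have lt: "0 < (5::nat)" "1 < (5::nat)" "2 < (5::nat)" "3 < (5::nat)" by simp_all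
    have B02: "- (B 0 2 * \<zeta> p) = - (W 0 1 2 * C 0 2 3 4 s) + W 0 2 3 * C 0 1 2 4 s - W 0 2 4 * C 0 1 2 3 s
        - x 0 s * T 2 + x 2 s * T 0"
      using B_eq[of 0 2 1 3] by (simp add: B_perm T_perm W_perm C_perm lt del: One_nat_def)
    have B03: "B 0 3 * \<zeta> p = W 0 1 3 * C 0 2 3 4 s - W 0 2 3 * C 0 1 3 4 s + W 0 3 4 * C 0 1 2 3 s
        + x 0 s * T 3 - x 3 s * T 0"
      using B_eq[of 0 3 1 2] by (simp add: B_perm T_perm W_perm C_perm lt del: One_nat_def)
    have B12: "B 1 2 * \<zeta> p = W 0 1 2 * C 1 2 3 4 s - W 1 2 3 * C 0 1 2 4 s + W 1 2 4 * C 0 1 2 3 s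
        + x 1 s * T 2 - x 2 s * T 1"
      using B_eq[of 1 2 0 3] by (simp add: B_perm T_perm W_perm C_perm lt del: One_nat_def)
    have B13: "- (B 1 3 * \<zeta> p) = - (W 0 1 3 * C 1 2 3 4 s) + W 1 2 3 * C 0 1 3 4 s - W 1 3 4 * C 0 1 2 3 s
        - x 1 s * T 3 + x 3 s * T 1"
      using B_eq[of 1 3 0 2] by (simp add: B_perm T_perm W_perm C_perm lt del: One_nat_def)
    have B23: "B 2 3 * \<zeta> p = W 0 2 3 * C 1 2 3 4 s - W 1 2 3 * C 0 2 3 4 s + W 2 3 4 * C 0 1 2 3 s
        + x 2 s * T 3 - x 3 s * T 2"
      using B_eq[of 2 3 0 1] by (simp add: B_perm T_perm W_perm C_perm lt del: One_nat_def)
    \<comment> \<open>The coordinate of the equality in S_2 at g_t g_t; on the diagonal no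
      symmetrization takes place.\<close>
    have N: "?N * \<zeta> p = T 0 * C 1 2 3 4 s - T 1 * C 0 2 3 4 s + T 2 * C 0 1 3 4 s - T 3 * C 0 1 2 4 s + T 4 * C 0 1 2 3 s"
    proof -
      have I: "[0, 1, 2, 3, 4] \<in> index_lists 5 X" using rk by (simp add: index_lists_def)
      have "t < rk3 X" using rk t by simp
      from w(7)[unfolded is_w1_3_def, THEN conjunct2, THEN conjunct2, rule_format, OF I s p,
          unfolded eq_S2_def, THEN conjunct1, rule_format, OF this]
      show ?thesis unfolding iota sum_lessThan_small by (simp add: omit_def nths_Cons T_def C_def mult.commute)
    qed
    have L: "x 1 s * U 2 3 - x 2 s * U 1 3 + x 3 s * U 1 2 = y 0 * C 0 1 2 3 s - y 4 * C 1 2 3 4 s"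
      "x 0 s * U 2 3 - x 2 s * U 0 3 + x 3 s * U 0 2 = - (y 1 * C 0 1 2 3 s) - y 4 * C 0 2 3 4 s"
      "x 0 s * U 1 3 - x 1 s * U 0 3 + x 3 s * U 0 1 = y 2 * C 0 1 2 3 s - y 4 * C 0 1 3 4 s"
      "x 0 s * U 1 2 - x 1 s * U 0 2 + x 2 s * U 0 1 = - (y 3 * C 0 1 2 3 s) - y 4 * C 0 1 2 4 s"
    proof -
      have "(\<Sum>l<5. y l * C l 1 2 3 s) = y 0 * C 0 1 2 3 s - y 4 * C 1 2 3 4 s"
        "(\<Sum>l<5. y l * C l 0 2 3 s) = - (y 1 * C 0 1 2 3 s) - y 4 * C 0 2 3 4 s"
        "(\<Sum>l<5. y l * C l 0 1 3 s) = y 2 * C 0 1 2 3 s - y 4 * C 0 1 3 4 s"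
        "(\<Sum>l<5. y l * C l 0 1 2 s) = - (y 3 * C 0 1 2 3 s) - y 4 * C 0 1 2 4 s"
        unfolding sum_lessThan_small using s by (simp_all add: C_sort C_zero)
      then show "x 1 s * U 2 3 - x 2 s * U 1 3 + x 3 s * U 1 2 = y 0 * C 0 1 2 3 s - y 4 * C 1 2 3 4 s"
        "x 0 s * U 2 3 - x 2 s * U 0 3 + x 3 s * U 0 2 = - (y 1 * C 0 1 2 3 s) - y 4 * C 0 2 3 4 s"
        "x 0 s * U 1 3 - x 1 s * U 0 3 + x 3 s * U 0 1 = y 2 * C 0 1 2 3 s - y 4 * C 0 1 3 4 s"
        "x 0 s * U 1 2 - x 1 s * U 0 2 + x 2 s * U 0 1 = - (y 3 * C 0 1 2 3 s) - y 4 * C 0 1 2 4 s"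
        by (simp_all only: L1[OF lt(2-4)] L1[OF lt(1,3,4)] L1[OF lt(1,2,4)] L1[OF lt(1-3)])
    qed
    have "?d * \<zeta> p = 2 * (y 4 * (?N * \<zeta> p)) + ((K 0 * \<zeta> p) * C 1 2 3 4 s + (- (K 1 * \<zeta> p)) * C 0 2 3 4 s
        + (K 2 * \<zeta> p) * C 0 1 3 4 s + (- (K 3 * \<zeta> p)) * C 0 1 2 4 s + (K 4 * \<zeta> p) * C 0 1 2 3 s)
        - (U 2 3 * (B 0 1 * \<zeta> p) + U 1 3 * (- (B 0 2 * \<zeta> p)) + U 1 2 * (B 0 3 * \<zeta> p) + U 0 3 * (B 1 2 * \<zeta> p)
          + U 0 2 * (- (B 1 3 * \<zeta> p)) + U 0 1 * (B 2 3 * \<zeta> p))"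
      by (simp only: ring_expand, simp only: mult_ac, simp)
    \<comment> \<open>All products of a \<open>W\<close>, a \<open>U\<close> and a \<open>C\<close>
      cancel between the \<open>K\<close> and the \<open>B\<close> equations. There remain the
      multiples of \<open>\<delta>\<close>, which vanish by \<open>P\<close>, and the multiples of
      the \<open>T i\<close>, which vanish by \<open>L\<close>.\<close>
    also have "\<dots> = \<delta> * (P 0 * C 1 2 3 4 s - P 1 * C 0 2 3 4 s + P 2 * C 0 1 3 4 s - P 3 * C 0 1 2 4 s
          + P 4 * C 0 1 2 3 s - half * \<Omega> * C 0 1 2 3 s)
        + y 4 * (T 0 * C 1 2 3 4 s - T 1 * C 0 2 3 4 s + T 2 * C 0 1 3 4 s - T 3 * C 0 1 2 4 s)
        - (y 0 * T 0 + y 1 * T 1 + y 2 * T 2 + y 3 * T 3) * C 0 1 2 3 s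
        + T 0 * (x 1 s * U 2 3 - x 2 s * U 1 3 + x 3 s * U 1 2) - T 1 * (x 0 s * U 2 3 - x 2 s * U 0 3 + x 3 s * U 0 2)
        + T 2 * (x 0 s * U 1 3 - x 1 s * U 0 3 + x 3 s * U 0 1) - T 3 * (x 0 s * U 1 2 - x 1 s * U 0 2 + x 2 s * U 0 1)"
      unfolding N K0 K1 K2 K3 K4 B01 B02 B03 B12 B13 B23
      by (simp only: ring_expand, simp only: mult_ac, simp)
    also have "\<dots> = 0"
      unfolding L P by (simp only: ring_expand, simp only: mult_ac, simp)
    finally show ?thesis .
  qed
  obtain d where d: "d = ?d" by simp
  have "d = 0"
  proof -
    \<comment> \<open>Up to sign \<open>\<zeta>\<close> is column \<open>1 - t\<close> of
      \<open>diff3\<close>, so injectivity is applied to the family with value \<open>d\<close> at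
      \<open>1 - t\<close> and 0 elsewhere.\<close>
    have "(if 1 - t = 1 - t then d else 0) = 0"
    proof (rule exact_tail_inj[OF X, where u = "\<lambda>t'. if t' = 1 - t then d else 0" and u' = "\<lambda>_. 0"])
      show "1 - t < rk3 X" using rk by simp
      fix p assume "p < rk2 X"
      then have "d * \<zeta> p = 0" unfolding d by (rule d\<zeta>)
      then show "(\<Sum>t'<rk3 X. diff3 X $$ (p, t') * (if t' = 1 - t then d else 0)) = (\<Sum>t'<rk3 X. diff3 X $$ (p, t') * 0)"
        using t rk by (auto simp: \<zeta>_def less_2_cases_iff sum_lessThan_small mult.commute)
    qed
    then show ?thesis by simp
  qed
  then show ?thesis unfolding d y_def by (rule eq_iff_diff_eq_0[THEN iffD2])
qed

section \<open>The linked complex\<close>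

lemma diff3_linked_complex:
  "h < rk2 A \<Longrightarrow> k < rk1 A - 4 \<Longrightarrow> diff3 (linked_complex A w) $$ (h, k) = diff2 A $$ (k + 4, h)"
  by (simp add: linked_complex_def)

lemma d1_linked_complex:
  "i < 4 \<Longrightarrow> s < 2 \<Longrightarrow> d1 (linked_complex A w) (rk3 A + i) s = d1 A i s"
  "t < rk3 A \<Longrightarrow> s < 2 \<Longrightarrow> d1 (linked_complex A w) t s = w1_1 w [0, 1, 2, 3] s t"
  by (simp_all add: linked_complex_def d1_def beta3_def)

text \<open>Restated with the index \<open>k\<close> that a basis element of D_3 has in the linked
  complex; in A_1 the same element has index \<open>k + 4\<close>.\<close>

lemma lower_mapsD:
  assumes "lower_maps A w v"
  shows "i < 4 \<Longrightarrow> j < 4 \<Longrightarrow> t < rk3 A \<Longrightarrow> h < rk2 A \<Longrightarrow> w3_1 v [sidx A i, sidx A j, t] h = w2_1 w [i, j] h t"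
    "i < 4 \<Longrightarrow> u < rk3 A \<Longrightarrow> t < u \<Longrightarrow> h < rk2 A \<Longrightarrow> w3_1 v [sidx A i, t, u] h = - w2_21 w [0, 1, 2, 3] i h t u"
    "i < 4 \<Longrightarrow> j < 4 \<Longrightarrow> l < 4 \<Longrightarrow> t < rk3 A \<Longrightarrow> s < 2 \<Longrightarrow> k + 4 < rk1 A \<Longrightarrow>
       w1_1 v [sidx A i, sidx A j, sidx A l, t] s k = - w1_1 w [i, j, l, k + 4] s t"
    "i < 4 \<Longrightarrow> j < 4 \<Longrightarrow> u < rk3 A \<Longrightarrow> t < u \<Longrightarrow> s < 2 \<Longrightarrow> k + 4 < rk1 A \<Longrightarrow>
       w1_1 v [sidx A i, sidx A j, t, u] s k = w1_21 w [0, 1, 2, 3, k + 4] [i, j] s t u"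
    "j < 4 \<Longrightarrow> t < rk3 A \<Longrightarrow> h < rk2 A \<Longrightarrow> k + 4 < rk1 A \<Longrightarrow>
       w3_21 v (sigma A @ [t]) (sidx A j) h k = w2_1 w [k + 4, j] h t"
    "t < rk3 A \<Longrightarrow> h < rk2 A \<Longrightarrow> k + 4 < rk1 A \<Longrightarrow>
       w3_21 v (sigma A @ [t]) t h k = w2_22 w [0, 1, 2, 3, k + 4] h t t"
    "u < rk3 A \<Longrightarrow> t < u \<Longrightarrow> h < rk2 A \<Longrightarrow> k + 4 < rk1 A \<Longrightarrow>
       w3_22 v (sigma A @ [t, u]) h k = - w2_21 w [0, 1, 2, 3] (k + 4) h t u"
proof -
  note l = assms[unfolded lower_maps_def, THEN conjunct2]
  show "i < 4 \<Longrightarrow> j < 4 \<Longrightarrow> t < rk3 A \<Longrightarrow> h < rk2 A \<Longrightarrow> w3_1 v [sidx A i, sidx A j, t] h = w2_1 w [i, j] h t"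
    "i < 4 \<Longrightarrow> u < rk3 A \<Longrightarrow> t < u \<Longrightarrow> h < rk2 A \<Longrightarrow> w3_1 v [sidx A i, t, u] h = - w2_21 w [0, 1, 2, 3] i h t u"
    using l[THEN conjunct1, rule_format, of i j t h] l[THEN conjunct2, THEN conjunct1, rule_format, of i u t h] by simp_all
  note l = l[THEN conjunct2, THEN conjunct2]
  show "i < 4 \<Longrightarrow> j < 4 \<Longrightarrow> l < 4 \<Longrightarrow> t < rk3 A \<Longrightarrow> s < 2 \<Longrightarrow> k + 4 < rk1 A \<Longrightarrow>
       w1_1 v [sidx A i, sidx A j, sidx A l, t] s k = - w1_1 w [i, j, l, k + 4] s t"
    using l[THEN conjunct1, rule_format, of i j l t s "k + 4"] by simp
  note l = l[THEN conjunct2]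
  show "i < 4 \<Longrightarrow> j < 4 \<Longrightarrow> u < rk3 A \<Longrightarrow> t < u \<Longrightarrow> s < 2 \<Longrightarrow> k + 4 < rk1 A \<Longrightarrow>
       w1_1 v [sidx A i, sidx A j, t, u] s k = w1_21 w [0, 1, 2, 3, k + 4] [i, j] s t u"
    using l[THEN conjunct1, rule_format, of i j u t s "k + 4"] by simp
  note l = l[THEN conjunct2]
  show "j < 4 \<Longrightarrow> t < rk3 A \<Longrightarrow> h < rk2 A \<Longrightarrow> k + 4 < rk1 A \<Longrightarrow>
       w3_21 v (sigma A @ [t]) (sidx A j) h k = w2_1 w [k + 4, j] h t"
    using l[THEN conjunct1, rule_format, of j t h "k + 4"] by simp
  note l = l[THEN conjunct2]
  show "t < rk3 A \<Longrightarrow> h < rk2 A \<Longrightarrow> k + 4 < rk1 A \<Longrightarrow>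
       w3_21 v (sigma A @ [t]) t h k = w2_22 w [0, 1, 2, 3, k + 4] h t t"
    using l[THEN conjunct1, rule_format, of t h "k + 4"] by simp
  show "u < rk3 A \<Longrightarrow> t < u \<Longrightarrow> h < rk2 A \<Longrightarrow> k + 4 < rk1 A \<Longrightarrow>
       w3_22 v (sigma A @ [t, u]) h k = - w2_21 w [0, 1, 2, 3] (k + 4) h t u"
    using l[THEN conjunct2, rule_format, of u t h "k + 4"] by simp
qed

text \<open>With s_i first and \<gamma> second, the defining equation of \<open>w1_21\<close> turns
  into the right-hand side of \<open>w1_22_linkage\<close> for the transposition \<open>p\<close>.
  The sign of \<open>p\<close> occurs on both sides.\<close>

lemma linked_w1_21:
  fixes A D :: "'r::comm_ring_1 complex3"
  assumes two: "(2 :: 'r) dvd 1" and A: "exact_tail A" and D: "exact_tail D"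
    and w: "structure_maps_of A w" and v: "structure_maps_of D v" and lower: "lower_maps A w v"
    and DA: "D = linked_complex A w" and fA: "rk1 A = 6" "rk2 A = 5" "rk3 A = 1"
    and i: "i < 4" and s: "s < 2"
  shows "w1_21 v (sigma A @ [0]) [sidx A i, 0] s 0 1 = w1_22 w [0, 1, 2, 3, 4, 5] i s 0 0" (is "?L = ?N")
proof -
  have fD: "rk1 D = 5" "rk2 D = 5" "rk3 D = 2" unfolding DA linked_complex_def by (simp_all add: fA)
  define p where "p = transpose 0 i"
  define \<epsilon> :: 'r where "\<epsilon> = (if i = 0 then 1 else - 1)"
  have \<epsilon>\<epsilon>: "\<epsilon> * (\<epsilon> * r) = r" for r by (simp add: \<epsilon>_def)
  have i4: "i = 0 \<or> i = 1 \<or> i = 2 \<or> i = 3" using i by auto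
  have p: "p 0 = i" "p 4 = 4" "p 5 = 5" "p 0 < 4" "p 1 < 4" "p 2 < 4" "p 3 < 4"
    using i4 by (auto simp: p_def transpose_def)
  have p_list: "[0, 1, 2, 3, 4, 5][0 := i, i := 0] = [p 0, p 1, p 2, p 3, 4, 5]"
    "[0, 1, 2, 3, 4][0 := i, i := 0] = [p 0, p 1, p 2, p 3, 4]"
    "[0, 1, 2, 3][0 := i, i := 0] = [p 0, p 1, p 2, p 3]"
    "(sigma A @ [0])[0 := sidx A i, i := sidx A 0] = [sidx A (p 0), sidx A (p 1), sidx A (p 2), sidx A (p 3), 0]"
    using i4 by (auto simp: p_def transpose_def)
  have nth: "[0, 1, 2, 3, 4, 5] ! i = i" "[0, 1, 2, 3, 4] ! i = i" "[0, 1, 2, 3] ! i = i"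
    "(sigma A @ [0]) ! i = sidx A i" "(sigma A @ [0]) ! 0 = sidx A 0"
    using i4 by auto
  have pi: "bij_betw p {..<6} {..<6}"
    unfolding p_def using i by (intro bij_betw_imageI) (auto simp: inj_on_def transpose_def image_iff)
  have lt: "p 0 < rk1 A" "p 1 < rk1 A" "p 2 < rk1 A" "p 3 < rk1 A" "4 < rk1 A" "5 < rk1 A"
    "sidx A (p 0) < rk1 D" "sidx A (p 1) < rk1 D" "sidx A (p 2) < rk1 D" "sidx A (p 3) < rk1 D" "0 < rk1 D"
    using p fA fD by simp_all
  have w': "is_w3_1 A w" "is_w2_1 A w" "is_w1_1 A w" "is_w3_22 A w" "is_w2_22 A w" "is_w1_22 A w"
    and v': "is_w3_1 D v" "is_w1_1 D v" "is_w3_21 D v" "is_w1_21 D v"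
    using w v fA fD unfolding structure_maps_of_def by simp_all
  have IL: "[0, 1, 2, 3, 4, 5] \<in> index_lists 6 A" "[0, 1, 2, 3, 4] \<in> index_lists 5 A"
    "[0, 1, 2, 3] \<in> index_lists 4 A" "sigma A @ [0] \<in> index_lists 5 D" "[sidx A i, 0] \<in> index_lists 2 D"
    using fA fD i by (simp_all add: index_lists_def)
  let ?I = "[sidx A (p 0), sidx A (p 1), sidx A (p 2), sidx A (p 3), 0]"
  have L: "w1_21 v ?I [sidx A i, 0] s 0 1 = \<epsilon> * ?L"
  proof -
    have "alternating 5 D (\<lambda>I. w1_21 v I [sidx A i, 0] s 0 1)"
      using v'(4) IL s fD unfolding is_w1_21_def by simp
    from alternating_transpose[OF this IL(4), of i, unfolded nth nth_Cons_0 p_list] show ?thesis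
      using i by (simp add: \<epsilon>_def)
  qed
  have N: "w1_22 w [p 0, p 1, p 2, p 3, 4, 5] i s 0 0 = \<epsilon> * ?N"
  proof -
    have "alternating 6 A (\<lambda>I. w1_22 w I i s 0 0)"
      using w'(6) i s fA unfolding is_w1_22_def by simp
    from alternating_transpose[OF this IL(1), of i, unfolded nth nth_Cons_0 p_list] show ?thesis
      using i by (simp add: \<epsilon>_def)
  qed
  have C: "w1_1 w [p 0, p 1, p 2, p 3] s 0 = \<epsilon> * w1_1 w [0, 1, 2, 3] s 0"
  proof -
    have "alternating 4 A (\<lambda>I. w1_1 w I s 0)"
      using w'(3) s fA unfolding is_w1_1_def by simp
    from alternating_transpose[OF this IL(3), of i, unfolded nth nth_Cons_0 p_list] show ?thesis
      using i by (simp add: \<epsilon>_def)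
  qed
  \<comment> \<open>Coordinate 0 of \<open>iota\<close> sees only column 1 of the linked
    \<open>diff3\<close>, which is row 5 of \<open>diff2 A\<close>; hence families supported at
    index 1.\<close>
  have "(if 1 = (1 :: nat) then ?L else 0) = (if 1 = (1 :: nat) then ?N else 0)"
  proof (rule exact_tail_inj[OF D, where t = 1 and u = "\<lambda>t. if t = 1 then ?L else 0" and
        u' = "\<lambda>t. if t = 1 then ?N else 0"])
    show "1 < rk3 D" using fD by simp
    fix q assume "q < rk2 D"
    then have q: "q < rk2 A" using fA fD by simp
    have V: "w2_22 w [p 0, p 1, p 2, p 3, 4] q 0 0 = \<epsilon> * w2_22 w [0, 1, 2, 3, 4] q 0 0"
    proof -
      have "alternating 5 A (\<lambda>I. w2_22 w I q 0 0)"
        using w'(5) q fA unfolding is_w2_22_def by simp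
      from alternating_transpose[OF this IL(2), of i, unfolded nth nth_Cons_0 p_list] show ?thesis
        using i by (simp add: \<epsilon>_def)
    qed
    have T: "w3_21 v ?I a q 0 = \<epsilon> * w3_21 v (sigma A @ [0]) a q 0" if "a < rk1 D" for a
    proof -
      have "alternating 5 D (\<lambda>I. w3_21 v I a q 0)"
        using v'(3) q fA fD that unfolding is_w3_21_def by simp
      from alternating_transpose[OF this IL(4), of i, unfolded nth nth_Cons_0 p_list] show ?thesis
        using i by (simp add: \<epsilon>_def)
    qed
    define U where "U = (\<lambda>a b. w2_1 w [a, b] q 0)"
    define C' where "C' = (\<lambda>a b c. w1_1 w [a, b, c, 4] s 0)"
    define V' where "V' = w2_22 w [p 0, p 1, p 2, p 3, 4] q 0 0"
    define C0 where "C0 = w1_1 w [0, 1, 2, 3] s 0"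
    have VD: "w3_21 v ?I 0 q 0 = V'"
      and UD: "w3_21 v ?I (sidx A (p 0)) q 0 = \<epsilon> * w2_1 w [4, p 0] q 0"
      unfolding V'_def
      using T[of 0] T[of "sidx A (p 0)"] V lt p q fA lower_mapsD(5)[OF lower, of "p 0" 0 q 0]
        lower_mapsD(6)[OF lower, of 0 q 0] by simp_all
    have WD: "w3_1 v [sidx A a, 0, sidx A b] q = - U a b" if "a < 4" "b < 4" for a b
      using w3_1_swap(2)[OF v'(1), of q "sidx A a" "sidx A b" 0] lower_mapsD(1)[OF lower, of a b 0 q] that q fA fD
      by (simp add: U_def)
    have CD: "w1_1 v [sidx A a, 0, sidx A b, sidx A c] s 0 = - C' a b c"
      if "a < 4" "b < 4" "c < 4" for a b c
      using w1_1_swap(2)[OF v'(2) s, of 0 "sidx A a" "sidx A b" 0 "sidx A c"]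
        w1_1_swap(3)[OF v'(2) s, of 0 "sidx A a" "sidx A b" "sidx A c" 0]
        lower_mapsD(3)[OF lower, of a b c 0 s 0] that q fA fD s
      by (simp add: C'_def)
    have I_swap: "w1_21 v [sidx A (p 0), 0, sidx A (p 1), sidx A (p 2), sidx A (p 3)] [sidx A i, 0] s 0 1 = - (\<epsilon> * ?L)"
    proof -
      have "alternating 5 D (\<lambda>I. w1_21 v I [sidx A i, 0] s 0 1)"
        using v'(4) IL s fD unfolding is_w1_21_def by simp
      from alternating_5_cycle[OF this lt(7-11)] show ?thesis unfolding L .
    qed
    have T_swap: "w3_21 v [sidx A (p 0), 0, sidx A (p 1), sidx A (p 2), sidx A (p 3)] a q 0 = - w3_21 v ?I a q 0"
      if "a < rk1 D" for a
    proof -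
      have "alternating 5 D (\<lambda>I. w3_21 v I a q 0)"
        using v'(3) q fA fD that unfolding is_w3_21_def by simp
      from alternating_5_cycle[OF this lt(7-11)] show ?thesis .
    qed
    define y where "y = diff2 A $$ (5, q)"
    have yD: "diff3 D $$ (q, 1) = y"
      using diff3_linked_complex[of q A 1 w] q fA by (simp add: DA y_def)
    let ?J = "[sidx A (p 0), 0, sidx A (p 1), sidx A (p 2), sidx A (p 3)]"
    have "w2_1 w [4, p 0] q 0 = - U (p 0) 4"
      using w2_1_swap[OF w'(2) q, of 0 "p 0" 4] lt fA by (simp add: U_def)
    then have UD': "w3_21 v ?I (sidx A (p 0)) q 0 = - (\<epsilon> * U (p 0) 4)" using UD by simp
    \<comment> \<open>Two minus signs cancel: one from moving \<gamma> to the second place, one from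
      \<open>iota_rank2\<close> in coordinate 0.\<close>
    have "iota D (w1_21 v ?J [sidx A i, 0] s) q 0 = \<epsilon> * ?L * y"
      using iota_rank2[OF fD(3), of 0] by (simp add: I_swap[unfolded One_nat_def] yD[unfolded One_nat_def])
    moreover have "iota D (w1_21 v ?J [sidx A (p 0), 0] s) q 0
      = U (p 0) (p 1) * C' (p 0) (p 2) (p 3) - U (p 0) (p 2) * C' (p 0) (p 1) (p 3)
        + U (p 0) (p 3) * C' (p 0) (p 1) (p 2) - d1 A (p 0) s * V' - C0 * (\<epsilon> * U (p 0) 4)"
    proof -
      have "d1 D (sidx A (p 0)) s = d1 A (p 0) s" "d1 D 0 s = C0"
        using d1_linked_complex[where s = s and A = A and w = w] p s fA unfolding DA C0_def by simp_all
      moreover have "iota D (w1_21 v ?J [sidx A (p 0), 0] s) q 0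
        = w3_1 v [sidx A (p 0), 0, sidx A (p 1)] q * w1_1 v [sidx A (p 0), 0, sidx A (p 2), sidx A (p 3)] s 0
          - w3_1 v [sidx A (p 0), 0, sidx A (p 2)] q * w1_1 v [sidx A (p 0), 0, sidx A (p 1), sidx A (p 3)] s 0
          + w3_1 v [sidx A (p 0), 0, sidx A (p 3)] q * w1_1 v [sidx A (p 0), 0, sidx A (p 1), sidx A (p 2)] s 0
          + d1 D (sidx A (p 0)) s * w3_21 v ?J 0 q 0 - d1 D 0 s * w3_21 v ?J (sidx A (p 0)) q 0"
        using w1_21_expand[OF v'(4) fD(1,3), of "sidx A (p 0)" 0 "sidx A (p 1)" "sidx A (p 2)" "sidx A (p 3)" s q 0]
          lt s \<open>q < rk2 D\<close> fD by simp
      ultimately show ?thesis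
        by (simp only: WD CD p(4-7) T_swap lt VD UD') simp
    qed
    moreover have "y * (\<epsilon> * ?N) = U (p 0) (p 1) * C' (p 0) (p 2) (p 3) - U (p 0) (p 2) * C' (p 0) (p 1) (p 3)
        + U (p 0) (p 3) * C' (p 0) (p 1) (p 2) - U (p 0) 4 * (\<epsilon> * C0) - d1 A (p 0) s * V'"
      using w1_22_linkage[OF A two fA(1,3) w' pi s q] N C
      by (simp add: p y_def U_def C'_def V'_def C0_def)
    ultimately have "\<epsilon> * ?L * y = y * (\<epsilon> * ?N)"
      unfolding p(1) by (simp add: mult_ac)
    then have "\<epsilon> * (\<epsilon> * (y * ?L)) = \<epsilon> * (\<epsilon> * (y * ?N))" by (simp add: mult_ac)
    then have "y * ?L = y * ?N" unfolding \<epsilon>\<epsilon> .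
    then show "(\<Sum>t<rk3 D. diff3 D $$ (q, t) * (if t = 1 then ?L else 0)) = (\<Sum>t<rk3 D. diff3 D $$ (q, t) * (if t = 1 then ?N else 0))"
      using yD unfolding fD sum_lessThan_small by simp
  qed
  then show ?thesis by simp
qed

text \<open>With the distinguished \<gamma> first and the other one second, the defining equation of
  \<open>w1_22\<close> turns into the right-hand side of \<open>w1_3_linkage\<close>, times the sign
  \<open>\<eta>\<close> of the order of the two.\<close>

lemma linked_w1_22:
  fixes A D :: "'r::comm_ring_1 complex3"
  assumes two: "(2 :: 'r) dvd 1" and A: "exact_tail A" and D: "exact_tail D"
    and w: "structure_maps_of A w" and v: "structure_maps_of D v" and lower: "lower_maps A w v"
    and DA: "D = linked_complex A w" and fA: "rk1 A = 5" "rk2 A = 5" "rk3 A = 2"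
    and t: "t < 2" and s: "s < 2"
  shows "w1_22 v (sigma A @ [0, 1]) t s 0 0 = w1_3 w [0, 1, 2, 3, 4] [0, 1, 2, 3, 4] s 0 1 t" (is "?L = ?N")
proof -
  have fD: "rk1 D = 6" "rk2 D = 5" "rk3 D = 1" unfolding DA linked_complex_def by (simp_all add: fA)
  define t' where "t' = 1 - t"
  define \<eta> :: 'r where "\<eta> = (if t = 0 then 1 else - 1)"
  have \<eta>\<eta>: "\<eta> * (\<eta> * r) = r" for r by (simp add: \<eta>_def)
  have tt: "t = 0 \<and> t' = 1 \<or> t = 1 \<and> t' = 0" using t by (auto simp: t'_def)
  have lt: "t < rk1 D" "t' < rk1 D" "i < 4 \<Longrightarrow> sidx A i < rk1 D" for i
    using tt fA fD by auto
  have sets: "{t, t', sidx A 0, sidx A 1, sidx A 2, sidx A 3} \<subseteq> {..<rk1 D}"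
    "{sidx A 0, sidx A 1, sidx A 2, sidx A 3, 0, 1} \<subseteq> {..<rk1 D}"
    using tt fA fD by auto
  have w': "is_w3_1 A w" "is_w2_1 A w" "is_w1_1 A w" "is_w3_21 A w" "is_w2_21 A w" "is_w1_21 A w" "is_w1_3 A w"
    and v': "is_w3_1 D v" "is_w1_1 D v" "is_w3_22 D v" "is_w1_22 D v"
    using w v fA fD unfolding structure_maps_of_def by simp_all
  let ?I = "[t, t', sidx A 0, sidx A 1, sidx A 2, sidx A 3]"
  have rotate: "\<phi> ?I = \<eta> * \<phi> (sigma A @ [0, 1])" if "alternating 6 D \<phi>" for \<phi>
  proof -
    have "\<phi> ?I = \<phi> [sidx A 0, sidx A 1, sidx A 2, sidx A 3, t, t']"
      by (rule alternating_6_cycle(1)[OF that sets(1)])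
    also have "\<dots> = \<eta> * \<phi> [sidx A 0, sidx A 1, sidx A 2, sidx A 3, 0, 1]"
      using tt alternating_6_cycle(2)[OF that sets(2)] by (auto simp: \<eta>_def)
    finally show ?thesis by simp
  qed
  have L: "w1_22 v ?I t s 0 0 = \<eta> * ?L"
    using v'(4) lt s fD unfolding is_w1_22_def by (intro rotate) simp
  have "?L = ?N"
  proof (rule exact_tail_inj[OF D, where t = 0 and u = "\<lambda>_. ?L" and u' = "\<lambda>_. ?N"])
    show "0 < rk3 D" using fD by simp
    fix q assume qD: "q < rk2 D"
    then have q: "q < rk2 A" using fA fD by simp
    define U where "U = (\<lambda>i j. w2_1 w [i, j] q t)"
    define K where "K = (\<lambda>i. w2_21 w [0, 1, 2, 3] i q 0 1)"
    define B where "B = (\<lambda>i j. w1_21 w [0, 1, 2, 3, 4] [i, j] s 0 1)"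
    define C where "C = (\<lambda>i j k l. w1_1 w [i, j, k, l] s t)"
    define y where "y = diff2 A $$ (4, q)"
    have KD: "w3_1 v [t, t', sidx A i] q = - (\<eta> * K i)" if "i < 4" for i
    proof -
      have "w3_1 v [sidx A i, 0, 1] q = - K i"
        using lower_mapsD(2)[OF lower, of i 1 0 q] that q fA by (simp add: K_def)
      moreover have "w3_1 v [sidx A i, t, t'] q = \<eta> * w3_1 v [sidx A i, 0, 1] q"
        using tt w3_1_swap(2)[OF v'(1) qD, of "sidx A i" 0 1] lt(3)[OF that] fD by (auto simp: \<eta>_def)
      moreover have "w3_1 v [t, t', sidx A i] q = w3_1 v [sidx A i, t, t'] q"
        using w3_1_swap(2)[OF v'(1) qD lt(1) lt(3)[OF that] lt(2)] w3_1_swap(1)[OF v'(1) qD lt(3)[OF that] lt(1,2)]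
        by simp
      ultimately show ?thesis by simp
    qed
    have UD: "w3_1 v [t, sidx A i, sidx A j] q = U i j" if "i < 4" "j < 4" for i j
    proof -
      note lti = lt(3)[OF that(1)] and ltj = lt(3)[OF that(2)]
      have "w3_1 v [t, sidx A i, sidx A j] q = w3_1 v [sidx A i, sidx A j, t] q"
        using w3_1_swap(1)[OF v'(1) qD lti lt(1) ltj] w3_1_swap(2)[OF v'(1) qD lti ltj lt(1)] by simp
      then show ?thesis using lower_mapsD(1)[OF lower that, of t q] t q fA by (simp add: U_def)
    qed
    have CD: "w1_1 v [t, sidx A i, sidx A j, sidx A k] s 0 = C i j k 4" if "i < 4" "j < 4" "k < 4" for i j k
    proof -
      note lti = lt(3)[OF that(1)] and ltj = lt(3)[OF that(2)] and ltk = lt(3)[OF that(3)]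
      have z: "0 < rk3 D" using fD by simp
      have "w1_1 v [t, sidx A i, sidx A j, sidx A k] s 0 = - w1_1 v [sidx A i, sidx A j, sidx A k, t] s 0"
        using w1_1_swap(1)[OF v'(2) s z lti lt(1) ltj ltk] w1_1_swap(2)[OF v'(2) s z lti ltj lt(1) ltk]
          w1_1_swap(3)[OF v'(2) s z lti ltj ltk lt(1)] by simp
      then show ?thesis using lower_mapsD(3)[OF lower that, of t s 0] t s fA by (simp add: C_def)
    qed
    have BD: "w1_1 v [t, t', sidx A i, sidx A j] s 0 = \<eta> * B i j" if "i < 4" "j < 4" for i j
    proof -
      note lti = lt(3)[OF that(1)] and ltj = lt(3)[OF that(2)]
      have z: "0 < rk3 D" using fD by simp
      have "w1_1 v [t, t', sidx A i, sidx A j] s 0 = w1_1 v [sidx A i, sidx A j, t, t'] s 0"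
        using w1_1_swap(2)[OF v'(2) s z lt(1) lti lt(2) ltj] w1_1_swap(1)[OF v'(2) s z lti lt(1,2) ltj]
          w1_1_swap(3)[OF v'(2) s z lti lt(1) ltj lt(2)] w1_1_swap(2)[OF v'(2) s z lti ltj lt(1,2)] by simp
      also have "\<dots> = \<eta> * w1_1 v [sidx A i, sidx A j, 0, 1] s 0"
        using tt w1_1_swap(3)[OF v'(2) s z lti ltj, of 0 1] fD by (auto simp: \<eta>_def)
      also have "w1_1 v [sidx A i, sidx A j, 0, 1] s 0 = B i j"
        using lower_mapsD(4)[OF lower that, of 1 0 s 0] s fA by (simp add: B_def)
      finally show ?thesis .
    qed
    have FD: "w3_22 v ?I q 0 = - (\<eta> * K 4)"
    proof -
      have "w3_22 v ?I q 0 = \<eta> * w3_22 v (sigma A @ [0, 1]) q 0"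
        using v'(3) qD fD unfolding is_w3_22_def by (intro rotate) simp
      then show ?thesis using lower_mapsD(7)[OF lower, of 1 0 q 0] q fA by (simp add: K_def)
    qed
    have dD: "d1 D t s = C 0 1 2 3"
      using d1_linked_complex(2)[of t A s w] t s fA unfolding DA C_def by simp
    have yD: "diff3 D $$ (q, 0) = y"
      using diff3_linked_complex[of q A 0 w] q fA by (simp add: DA y_def)
    have I: "?I \<in> index_lists 6 D" using sets(1) by (simp add: index_lists_def)
    have z: "0 < rk3 D" using fD by simp
    have four: "0 < (4::nat)" "1 < (4::nat)" "2 < (4::nat)" "3 < (4::nat)" by simp_all
    \<comment> \<open>The doubling comes from \<open>kappa\<close> in rank one. Of the ten products
      in \<open>w1_22_expand\<close>, four give \<open>K 0\<close> to \<open>K 3\<close> and six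
      give the products of \<open>U\<close> and \<open>B\<close>; the term with \<open>d1\<close>
      gives \<open>K 4\<close>.\<close>
    have "2 * (y * (\<eta> * ?L)) = kappa D (w1_22 v ?I t s) q 0"
      using fD L by (simp add: kappa_def yD mult_ac)
    also have "\<dots> = \<eta> * (- (K 0 * C 1 2 3 4 - K 1 * C 0 2 3 4 + K 2 * C 0 1 3 4 - K 3 * C 0 1 2 4 + K 4 * C 0 1 2 3)
      + (U 2 3 * B 0 1 - U 1 3 * B 0 2 + U 1 2 * B 0 3 + U 0 3 * B 1 2 - U 0 2 * B 1 3 + U 0 1 * B 2 3))"
      unfolding w1_22_expand[OF v'(4) I s qD z] KD[OF four(1)] KD[OF four(2)] KD[OF four(3)] KD[OF four(4)] FD dD
      by (simp only: UD CD BD four) (simp only: ring_expand, simp only: mult_ac, simp)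
    also have "\<dots> = \<eta> * (2 * (y * ?N))"
      using w1_3_linkage[OF A two fA(1,3) w' s q t] by (simp add: y_def U_def K_def B_def C_def)
    finally have "2 * (y * (\<eta> * ?L)) = \<eta> * (2 * (y * ?N))" .
    then have "2 * (\<eta> * (y * ?L)) = 2 * (\<eta> * (y * ?N))" by (simp only: mult_ac)
    then have "half * (2 * (\<eta> * (y * ?L))) = half * (2 * (\<eta> * (y * ?N)))" by (rule arg_cong)
    then have "\<eta> * (\<eta> * (y * ?L)) = \<eta> * (\<eta> * (y * ?N))" unfolding half_double(1)[OF two] by (rule arg_cong)
    then have "y * ?L = y * ?N" unfolding \<eta>\<eta> .
    then show "(\<Sum>t<rk3 D. diff3 D $$ (q, t) * ?L) = (\<Sum>t<rk3 D. diff3 D $$ (q, t) * ?N)"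
      using yD unfolding fD sum_lessThan_small by simp
  qed
  then show ?thesis .
qed

theorem theorem3p9:
  fixes \<mm> :: "'r::comm_ring_1 set"
    and A D :: "'r complex3"
    and M :: "('r, 'b) module" and \<pi> :: "'r vec \<Rightarrow> 'b"
    and M' :: "('r, 'c) module" and \<pi>' :: "'r vec \<Rightarrow> 'c"
    and w v :: "'r structure_maps"
  assumes gor: "gorenstein (type_ring :: 'r ring)"
    and base: "is_local \<mm> \<or> (\<exists>G. is_graded_local G \<mm> \<and> homogeneous_complex G A)"
    and residue_field: "infinite (carrier (type_ring Quot \<mm>))"
    and two: "(2 :: 'r) dvd 1"
    and A_res: "free_resolution A M \<pi>"
    and A_min: "minimal_complex \<mm> A"
    and perf: "perfect_module type_ring M"
    and ht: "height type_ring (minors_ideal4 A) = 3"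
    and w: "structure_maps_of A w"
    and D: "D = linked_complex A w"
    and D_res: "free_resolution D M' \<pi>'"
    and v: "structure_maps_of D v"
    and lower: "lower_maps A w v"
  shows "(format A = (2, 6, 5, 1) \<and> format D = (2, 5, 5, 2) \<longrightarrow>
           (\<forall>i<4. \<forall>t<1. \<forall>j<2.
              w1_21 v (sigma A @ [t]) [sidx A i, t] j 0 1 = w1_22 w [0, 1, 2, 3, 4, 5] i j t t))
       \<and> (format A = (2, 5, 5, 2) \<and> format D = (2, 6, 5, 1) \<longrightarrow>
           (\<forall>t<2. \<forall>j<2.
              w1_22 v (sigma A @ [0, 1]) t j 0 0 = w1_3 w [0, 1, 2, 3, 4] [0, 1, 2, 3, 4] j 0 1 t))"
proof (intro conjI impI allI)
  note exact = free_resolution_exact_tail[OF A_res] free_resolution_exact_tail[OF D_res]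
  fix i t j :: nat
  assume "format A = (2, 6, 5, 1) \<and> format D = (2, 5, 5, 2)" and lt: "i < 4" "t < 1" "j < 2"
  then have "rk1 A = 6" "rk2 A = 5" "rk3 A = 1" by (simp_all add: format_def)
  from linked_w1_21[OF two exact w v lower D this lt(1,3)] lt(2)
  show "w1_21 v (sigma A @ [t]) [sidx A i, t] j 0 1 = w1_22 w [0, 1, 2, 3, 4, 5] i j t t" by simp
next
  note exact = free_resolution_exact_tail[OF A_res] free_resolution_exact_tail[OF D_res]
  fix t j :: nat
  assume "format A = (2, 5, 5, 2) \<and> format D = (2, 6, 5, 1)" and lt: "t < 2" "j < 2"
  then have "rk1 A = 5" "rk2 A = 5" "rk3 A = 2" by (simp_all add: format_def)
  from linked_w1_22[OF two exact w v lower D this lt]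
  show "w1_22 v (sigma A @ [0, 1]) t j 0 0 = w1_3 w [0, 1, 2, 3, 4] [0, 1, 2, 3, 4] j 0 1 t" .
qed

end
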